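(* Let $\varphi=\pm\varphi_1\cdots\varphi_N$ be a pseudo-Anosov homeomorphism of the once-punctured torus written as a word in $L,R$ with $\varphi_1=L$, $\varphi_N=R$; let $m\in\mathbb{Z}$, let $q=e^{2\pi\mathsf{i}a/n}$ with $n$ odd and $(a,n)=1$, and let $\zeta=q^2$. With $H$, $\theta$, $z$, $a_{k,m}(\theta)$ and $\mathcal D$ as defined in the context, $$\mathrm{tr}\,H=\sum_{k\in(\mathbb{Z}/n\mathbb{Z})^N}\frac{a_{k,m}(\theta)}{n^{N/2}},\qquad \det H=\omega\prod_{i=1}^N z_i^{\frac{n-1}{2}}\,\mathcal D_{\zeta^{-1}}(\theta_i^{-1})^{-n},$$ where $\omega$ is the root of unity $$\omega=\left(\frac{-2}{n}\right)^N e^{-2\pi\mathsf{i}\,(2\#L+\#R)\,n\,s(-2a,n)},$$ with $\left(\frac{c}{d}\right)$ the Jacobi symbol, $s$ the Dedekind sum, and $\#L,\#R$ the numbers of letters $L$ and $R$ in $\varphi_1\cdots\varphi_N$.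
   Context: Notation: $(x;q)_k=(1-x)(1-qx)\cdots(1-q^{k-1}x)$ for $k\ge0$, extended to negative $k$ by $(x;q)_{k+l}=(x;q)_k(q^kx;q)_l$; logarithms are principal; a fraction $\frac12$ in an exponent of $q$ or $\zeta$ means $2^{-1}\bmod n$. $s(a,n)=\sum_{r=1}^{n-1}((\frac rn))((\frac{ar}n))$, where $((x))=x-\lfloor x\rfloor-\frac12$ for $x\notin\mathbb{Z}$ and $0$ for $x\in\mathbb{Z}$. For $\xi=e^{2\pi \mathsf{i}b/n}$ with $(b,n)=1$, $$\mathcal D_\xi(x)=\exp\Big(-\mathsf{i}\pi s(b,n)+\sum_{j=1}^{n-1}\tfrac jn\log(1-\xi^jx)\Big).$$ $L,R$ are the mapping classes of the once-punctured torus lifting to the linear maps $\begin{pmatrix}1&0\\1&1\end{pmatrix}$, $\begin{pmatrix}1&1\\0&1\end{pmatrix}$ of $\mathbb{R}^2\setminus\mathbb{Z}^2$. Up to conjugation, each pseudo-Anosov $\varphi$ is $\pm\varphi_1\cdots\varphi_N$ with $\varphi_i\in\{L,R\}$, both letters appearing; indices are in $\mathbb{Z}/N\mathbb{Z}$. The sign plays no role here. Neumann--Zagier data (of the layered triangulation of the mapping torus, with halved longitude equation): integer $N\times N$ matrices $A,B$ and $\nu\in\mathbb{Z}^N$ given as follows (unlisted entries are $0$; if indices coincide modulo $N$, contributions add). - For $i<N$, $\varphi_i=L$, and the next $L$ (cyclically) at $\varphi_{i+k}$, $k\ge1$: $A_{i,i-1}=A_{i,i+k}=1$; $B_{i,i}=\dots=B_{i,i+k-1}=2$;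 $\nu_i=2$. - For $i<N$, $\varphi_i=R$, and the next $R$ at $\varphi_{i+k}$: $A_{i,i-1}=A_{i,i+k}=1$, $A_{i,i}=\dots=A_{i,i+k-1}=-2$; $B_{i,i}=\dots=B_{i,i+k-1}=-2$; $\nu_i=2-2k$. - Row $N$: $A_{N,N-1}=-1$, $A_{N,N}=A_{N,1}=1$, $B_{N,N}=2$, $\nu_N=1$. $\frac12B$ is unimodular. Put $Q=2B^{-1}A$, $\eta=2B^{-1}\nu$. Let $z=(z_1,\dots,z_N)$ with $\mathrm{Im}\,z_j>0$ be the solution (complete hyperbolic structure) of $\sum_j(A_{ij}\log z_j'+B_{ij}\log z_j)=\pi\mathsf{i}\,\nu_i$ for $i=1,\dots,N$, where $z_j'=1/(1-z_j)$. Put $\theta_i=\exp(\frac1n\log z_i')$, so $\theta_i^n=z_i'$. Summand (the paper's 1-loop summand with $d=2$): for $k\in(\mathbb{Z}/n\mathbb{Z})^N$ and $e_N$ the $N$-th unit vector, $$a_{k,m}(\theta)=(-1)^{2k^tB^{-1}\nu}\,\zeta^{\frac12\left[4k^tB^{-1}Ak+2k^tB^{-1}(\nu-2m e_N)\right]}\prod_{i=1}^N\frac{\theta_i^{-(2B^{-1}Ak)_i}}{(\zeta\theta_i^{-1};\zeta)_{2k_i}}.$$ The matrix $H$: put - $\beta_i=-1$ if $\varphi_i\varphi_{i+1}=LR$, $\beta_i=1$ if $\varphi_i\varphi_{i+1}=RL$, and $\beta_i=0$ otherwise; - $d_i=q^{m\beta_i-\frac12\eta_i}\exp\big(\frac{1-n^2}{2n}\pi\mathsf{i}\,\eta_i-\frac1n\log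 z_i\big)$; - $D_i=\mathrm{diag}\big(d_i^k(\theta_i^{-1};q^{-2})_k\big)_{k\in\mathbb{Z}/n\mathbb{Z}}$ (the entries are $n$-periodic in $k$); - $\mathcal F_L=\frac1{\sqrt n}(q^{ij})_{i,j\in\mathbb{Z}/n\mathbb{Z}}$ and $\mathcal F_R=\frac1{\sqrt n}(q^{\frac12(i-j)^2})_{i,j\in\mathbb{Z}/n\mathbb{Z}}$; - $H_i=\mathcal F_{\varphi_i}D_i$ and $H=H_1H_2\cdots H_N$. *)

theory Defs
  imports
    "HOL-Analysis.Complex_Transcendental"
    "HOL-Number_Theory.Residues"
    "Jordan_Normal_Form.Determinant"
begin

section \<open>Number-theoretic and q-series notation\<close>

text \<open>The representative of the inverse of 2 modulo an odd \<open>n\<close>; it replaces every fraction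
  one half in an exponent of an \<open>n\<close>-th root of unity.\<close>
definition inv2 :: "nat \<Rightarrow> int" where
  "inv2 n = (int n + 1) div 2"

text \<open>The value at negative \<open>k\<close> is forced by \<open>(x;q)\<^sub>0 = (x;q)\<^sub>k (q\<^sup>k x;q)\<^sub>-\<^sub>k\<close>.\<close>
definition qpoch :: "complex \<Rightarrow> complex \<Rightarrow> int \<Rightarrow> complex" where
  "qpoch x q k =
     (if k \<ge> 0 then \<Prod>j<nat k. 1 - q ^ j * x
      else inverse (\<Prod>j<nat (- k). 1 - q ^ j * (q powi k * x)))"

definition sawtooth :: "real \<Rightarrow> real" where
  "sawtooth x = (if x \<in> \<int> then 0 else x - of_int \<lfloor>x\<rfloor> - 1 / 2)"

definition dedekind_sum :: "int \<Rightarrow> nat \<Rightarrow> real" where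
  "dedekind_sum a n =
     (\<Sum>r = 1..<n. sawtooth (real r / real n) * sawtooth (of_int a * real r / real n))"

definition jacobi :: "int \<Rightarrow> nat \<Rightarrow> int" where
  "jacobi c d = (\<Prod>p\<in>prime_factors d. Legendre c (int p) ^ multiplicity p d)"

text \<open>The primitive root of unity \<open>\<xi> = exp (2\<pi>\<i>b/n)\<close> enters through \<open>b\<close>; the value depends
  only on \<open>b\<close> modulo \<open>n\<close>. Here \<open>ln\<close> on \<open>complex\<close> is the principal branch.\<close>
definition cyclic_dilog :: "int \<Rightarrow> nat \<Rightarrow> complex \<Rightarrow> complex" where
  "cyclic_dilog b n x =
     (let \<xi> = exp (2 * pi * \<i> * of_int b / of_nat n)
      in exp (- \<i> * pi * dedekind_sum b n
              + (\<Sum>j = 1..<n. of_nat j / of_nat n * ln (1 - \<xi> ^ j * x))))"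


section \<open>Neumann--Zagier data of a word in L, R\<close>

datatype letter = L | R

text \<open>
  A word \<open>\<phi>\<^sub>1 \<dots> \<phi>\<^sub>N\<close> is a list, with \<open>\<phi>\<^sub>i\<close> being \<open>w ! (i - 1)\<close>. All indices are shifted
  to \<open>0, \<dots>, N - 1\<close> and read modulo \<open>N = length w\<close>; in particular row \<open>N\<close> of the
  Neumann--Zagier data is the row of index \<open>N - 1\<close>.
\<close>

text \<open>The least \<open>k \<ge> 1\<close> such that the letter at position \<open>i\<close> recurs, cyclically, at \<open>i + k\<close>.\<close>
definition gap :: "letter list \<Rightarrow> nat \<Rightarrow> nat" where
  "gap w i = (LEAST k. 1 \<le> k \<and> w ! ((i + k) mod length w) = w ! i)"

text \<open>The position \<open>i\<close> modulo \<open>N\<close> contributes 1 to column \<open>j\<close>. Summing these contributions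
  implements the convention that entries add up when indices coincide modulo \<open>N\<close>.\<close>
definition at_col :: "letter list \<Rightarrow> nat \<Rightarrow> nat \<Rightarrow> int" where
  "at_col w i j = of_bool (i mod length w = j)"

definition nzA :: "letter list \<Rightarrow> int mat" where
  "nzA w = (let N = length w in mat N N (\<lambda>(i, j).
     if i = N - 1 then - at_col w (i + N - 1) j + at_col w i j + at_col w (i + 1) j
     else at_col w (i + N - 1) j + at_col w (i + gap w i) j
          + (case w ! i of L \<Rightarrow> 0 | R \<Rightarrow> - 2 * (\<Sum>r<gap w i. at_col w (i + r) j))))"

definition nzB :: "letter list \<Rightarrow> int mat" where
  "nzB w = (let N = length w in mat N N (\<lambda>(i, j).
     if i = N - 1 then 2 * at_col w i j
     else (case w ! i of L \<Rightarrow> 2 | R \<Rightarrow> - 2) * (\<Sum>r<gap w i. at_col w (i + r) j)))"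

definition nznu :: "letter list \<Rightarrow> int vec" where
  "nznu w = (let N = length w in vec N (\<lambda>i.
     if i = N - 1 then 1
     else (case w ! i of L \<Rightarrow> 2 | R \<Rightarrow> 2 - 2 * int (gap w i))))"

text \<open>The integer matrix \<open>2 B\<^sup>-\<^sup>1\<close>, i.e. the inverse of the unimodular matrix \<open>B/2\<close>. Existence and
  uniqueness are shown in \<open>ex1_twoBinv\<close> below.\<close>
definition twoBinv :: "letter list \<Rightarrow> int mat" where
  "twoBinv w = (THE C. C \<in> carrier_mat (length w) (length w)
      \<and> C * nzB w = 2 \<cdot>\<^sub>m 1\<^sub>m (length w) \<and> nzB w * C = 2 \<cdot>\<^sub>m 1\<^sub>m (length w))"

definition nzQ :: "letter list \<Rightarrow> int mat" where
  "nzQ w = twoBinv w * nzA w"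

definition nzeta :: "letter list \<Rightarrow> int vec" where
  "nzeta w = twoBinv w *\<^sub>v nznu w"

definition shape' :: "(nat \<Rightarrow> complex) \<Rightarrow> nat \<Rightarrow> complex" where
  "shape' z j = 1 / (1 - z j)"

definition complete_structure :: "letter list \<Rightarrow> (nat \<Rightarrow> complex) \<Rightarrow> bool" where
  "complete_structure w z \<longleftrightarrow>
     (\<forall>j<length w. Im (z j) > 0) \<and>
     (\<forall>i<length w. (\<Sum>j<length w. of_int (nzA w $$ (i, j)) * ln (shape' z j)
                                 + of_int (nzB w $$ (i, j)) * ln (z j))
                    = pi * \<i> * of_int (nznu w $ i))"

definition shape_root :: "nat \<Rightarrow> (nat \<Rightarrow> complex) \<Rightarrow> nat \<Rightarrow> complex" where
  "shape_root n z i = exp (ln (shape' z i) / of_nat n)"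


section \<open>The 1-loop summand\<close>

text \<open>Since \<open>2 B\<^sup>-\<^sup>1\<close> is integral, the term \<open>4 k\<^sup>t B\<^sup>-\<^sup>1 A k\<close> is \<open>2 k\<^sup>t Q k\<close>, the term
  \<open>2 k\<^sup>t B\<^sup>-\<^sup>1 (\<nu> - 2 m e\<^sub>N)\<close> is \<open>k\<^sup>t (2 B\<^sup>-\<^sup>1) (\<nu> - 2 m e\<^sub>N)\<close>, and \<open>2 k\<^sup>t B\<^sup>-\<^sup>1 \<nu>\<close> is \<open>k\<^sup>t \<eta>\<close>.
  For \<open>\<theta>\<close> coming from the complete structure the value depends only on \<open>k\<close> modulo \<open>n\<close>.\<close>
definition summand ::
  "nat \<Rightarrow> complex \<Rightarrow> letter list \<Rightarrow> int \<Rightarrow> (nat \<Rightarrow> complex) \<Rightarrow> int vec \<Rightarrow> complex" where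
  "summand n \<zeta> w m \<theta> k = (let N = length w in
     (- 1) powi (k \<bullet> nzeta w)
     * \<zeta> powi (inv2 n * (2 * (k \<bullet> (nzQ w *\<^sub>v k))
                   + k \<bullet> (twoBinv w *\<^sub>v (nznu w - (2 * m) \<cdot>\<^sub>v unit_vec N (N - 1)))))
     * (\<Prod>i<N. \<theta> i powi (- ((nzQ w *\<^sub>v k) $ i)) / qpoch (\<zeta> / \<theta> i) \<zeta> (2 * k $ i)))"


section \<open>The matrix H\<close>

definition beta :: "letter list \<Rightarrow> nat \<Rightarrow> int" where
  "beta w i = (case (w ! i, w ! ((i + 1) mod length w)) of
     (L, R) \<Rightarrow> - 1 | (R, L) \<Rightarrow> 1 | _ \<Rightarrow> 0)"

definition diag_base ::
  "nat \<Rightarrow> complex \<Rightarrow> letter list \<Rightarrow> int \<Rightarrow> (nat \<Rightarrow> complex) \<Rightarrow> nat \<Rightarrow> complex" where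
  "diag_base n q w m z i =
     q powi (m * beta w i - inv2 n * (nzeta w $ i))
     * exp ((1 - of_nat n ^ 2) / (2 * of_nat n) * pi * \<i> * of_int (nzeta w $ i)
            - ln (z i) / of_nat n)"

definition diag_factor ::
  "nat \<Rightarrow> complex \<Rightarrow> letter list \<Rightarrow> int \<Rightarrow> (nat \<Rightarrow> complex) \<Rightarrow> nat \<Rightarrow> complex mat" where
  "diag_factor n q w m z i = mat n n (\<lambda>(k, l).
     if k = l then diag_base n q w m z i ^ k
                   * qpoch (1 / shape_root n z i) (q powi (- 2)) (int k)
     else 0)"

definition fourier_factor :: "nat \<Rightarrow> complex \<Rightarrow> letter \<Rightarrow> complex mat" where
  "fourier_factor n q x = mat n n (\<lambda>(i, j). of_real (1 / sqrt (real n)) *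
     (case x of L \<Rightarrow> q powi (int i * int j)
              | R \<Rightarrow> q powi (inv2 n * (int i - int j)\<^sup>2)))"

definition Hmat ::
  "nat \<Rightarrow> complex \<Rightarrow> letter list \<Rightarrow> int \<Rightarrow> (nat \<Rightarrow> complex) \<Rightarrow> complex mat" where
  "Hmat n q w m z =
     foldr (*) (map (\<lambda>i. fourier_factor n q (w ! i) * diag_factor n q w m z i) [0..<length w])
       (1\<^sub>m n)"

definition mat_trace :: "'a :: comm_monoid_add mat \<Rightarrow> 'a" where
  "mat_trace M = (\<Sum>i<dim_row M. M $$ (i, i))"


section \<open>Unimodularity of B/2\<close>

lemma gap_le:
  assumes "1 \<le> k" "w ! ((i + k) mod length w) = w ! i"
  shows "gap w i \<le> k"
  unfolding gap_def by (rule Least_le) (use assms in auto)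

lemma gap_pos:
  assumes "i < length w"
  shows "1 \<le> gap w i"
proof -
  have "1 \<le> length w \<and> w ! ((i + length w) mod length w) = w ! i"
    using assms by auto
  from LeastI[of "\<lambda>k. 1 \<le> k \<and> w ! ((i + k) mod length w) = w ! i", OF this]
  show ?thesis unfolding gap_def by auto
qed

lemma gap_no_wrap:
  assumes "w \<noteq> []" "hd w = L" "last w = R" "i < length w - 1"
  shows "i + gap w i \<le> length w"
proof (cases "w ! i")
  case L
  have "w ! ((i + (length w - i)) mod length w) = w ! i"
    using assms L by (simp add: hd_conv_nth)
  with assms have "gap w i \<le> length w - i" by (intro gap_le) auto
  with assms show ?thesis by linarith
next
  case R
  have "w ! ((i + (length w - 1 - i)) mod length w) = w ! i"
    using assms R by (simp add: last_conv_nth)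
  with assms have "gap w i \<le> length w - 1 - i" by (intro gap_le) auto
  with assms show ?thesis by linarith
qed

lemma ex1_twoBinv:
  assumes w: "w \<noteq> []" "hd w = L" "last w = R"
  shows "\<exists>!C. C \<in> carrier_mat (length w) (length w)
      \<and> C * nzB w = 2 \<cdot>\<^sub>m 1\<^sub>m (length w) \<and> nzB w * C = 2 \<cdot>\<^sub>m 1\<^sub>m (length w)"
proof -
  define N where "N = length w"
  have N0: "N > 0" using w by (auto simp: N_def)
  define u where "u = (\<lambda>i j. if i = N - 1 then at_col w i j
     else (case w ! i of L \<Rightarrow> 1 | R \<Rightarrow> - 1) * (\<Sum>r<gap w i. at_col w (i + r) j))"
  define U where "U = mat N N (\<lambda>(i, j). u i j)"
  have U: "U \<in> carrier_mat N N" by (simp add: U_def)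
  have B: "nzB w = 2 \<cdot>\<^sub>m U"
    by (rule eq_matI) (auto simp: nzB_def U_def u_def N_def Let_def split: letter.splits)
  have sum_col: "(\<Sum>r<gap w i. at_col w (i + r) j) = (if i \<le> j \<and> j < i + gap w i then 1 else 0)"
    if "i < N - 1" "j < N" for i j
  proof -
    have eq: "at_col w (i + r) j = (if r = j - i \<and> i \<le> j then 1 else 0)" if "r < gap w i" for r
    proof -
      have "i + r < length w"
        using gap_no_wrap[OF w, of i] that \<open>i < N - 1\<close> by (simp add: N_def)
      thus ?thesis by (auto simp: at_col_def)
    qed
    have "(\<Sum>r<gap w i. at_col w (i + r) j) =
          (\<Sum>r<gap w i. if r = j - i \<and> i \<le> j then 1 else 0)"
      by (rule sum.cong) (auto simp: eq)
    also have "\<dots> = (if i \<le> j \<and> j < i + gap w i then 1 else 0)"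
      by (cases "i \<le> j") auto
    finally show ?thesis .
  qed
  have last_col: "at_col w (N - 1) j = (if j = N - 1 then 1 else 0)" for j
    using N0 by (auto simp: at_col_def N_def)
  have u0: "u i j = 0" if "j < i" "i < N" for i j
  proof (cases "i = N - 1")
    case True
    with that show ?thesis by (simp add: u_def last_col[simplified])
  next
    case False
    with that have "i < N - 1" "j < N" by linarith+
    with that False show ?thesis by (simp add: u_def sum_col)
  qed
  have "upper_triangular U"
    by (auto simp: upper_triangular_def U_def u0)
  hence detU: "Determinant.det U = prod_list (diag_mat U)"
    by (rule det_upper_triangular) (use U in simp)
  have diag: "\<bar>U $$ (i, i)\<bar> = 1" if "i < N" for i
  proof (cases "i = N - 1")
    case True
    with that show ?thesis by (simp add: U_def u_def last_col[simplified])
  next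
    case False
    with that have "i < N - 1" by linarith
    moreover have "gap w i > 0" using gap_pos[of i w] that by (simp add: N_def)
    ultimately show ?thesis
      using that by (cases "w ! i") (simp_all add: U_def u_def sum_col)
  qed
  have abs_prod: "\<bar>prod_list xs\<bar> = 1" if "\<forall>x\<in>set xs. \<bar>x\<bar> = 1" for xs :: "int list"
    using that by (induction xs) (auto simp: abs_mult)
  have "\<bar>Determinant.det U\<bar> = 1"
    unfolding detU using U by (intro abs_prod) (auto simp: diag_mat_def diag)
  hence d2: "Determinant.det U * Determinant.det U = 1"
    by (metis abs_mult_self_eq mult.right_neutral)
  define V where "V = Determinant.det U \<cdot>\<^sub>m adj_mat U"
  have V: "V \<in> carrier_mat N N" unfolding V_def using adj_mat(1)[OF U] by simp
  have smult: "a \<cdot>\<^sub>m (b \<cdot>\<^sub>m M) = (a * b) \<cdot>\<^sub>m M" "1 \<cdot>\<^sub>m M = M" for a b and M :: "int mat"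
    by (rule eq_matI; simp)+
  have UV: "U * V = 1\<^sub>m N"
    unfolding V_def
    using adj_mat[OF U] U d2 by (simp add: mult_smult_distrib[of _ N N _ N] smult)
  have VU: "V * U = 1\<^sub>m N"
    unfolding V_def
    using adj_mat[OF U] U d2 by (simp add: mult_smult_assoc_mat[of _ N N _ N] smult)
  show ?thesis
    unfolding N_def[symmetric]
  proof (rule ex1I[of _ V])
    show "V \<in> carrier_mat N N \<and> V * nzB w = 2 \<cdot>\<^sub>m 1\<^sub>m N \<and> nzB w * V = 2 \<cdot>\<^sub>m 1\<^sub>m N"
      using U V UV VU
      by (simp add: B mult_smult_distrib[of _ N N _ N] mult_smult_assoc_mat[of _ N N _ N])
  next
    fix C assume C: "C \<in> carrier_mat N N \<and> C * nzB w = 2 \<cdot>\<^sub>m 1\<^sub>m N \<and> nzB w * C = 2 \<cdot>\<^sub>m 1\<^sub>m N"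
    have CU: "2 \<cdot>\<^sub>m (C * U) = 2 \<cdot>\<^sub>m 1\<^sub>m N"
      using C mult_smult_distrib[of C N N U N 2] U by (simp add: B)
    have "C * U = 1\<^sub>m N"
    proof (rule eq_matI)
      fix i j assume ij: "i < dim_row (1\<^sub>m N :: int mat)" "j < dim_col (1\<^sub>m N :: int mat)"
      have "(2 \<cdot>\<^sub>m (C * U)) $$ (i, j) = (2 \<cdot>\<^sub>m 1\<^sub>m N :: int mat) $$ (i, j)"
        by (simp only: CU)
      moreover have "(2 \<cdot>\<^sub>m (C * U)) $$ (i, j) = 2 * (C * U) $$ (i, j)"
        using ij C U by (intro index_smult_mat(1)) auto
      ultimately show "(C * U) $$ (i, j) = 1\<^sub>m N $$ (i, j)"
        using ij by (simp del: index_mult_mat(1))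
    qed (use C U in auto)
    have "C = C * (U * V)" using C UV right_mult_one_mat[of C N N] by simp
    also have "\<dots> = (C * U) * V" using C U V assoc_mult_mat[of C N N U N V N] by simp
    also have "\<dots> = V" using \<open>C * U = 1\<^sub>m N\<close> V by simp
    finally show "C = V" .
  qed
qed

end

theory Submission
  imports Defs "HOL-Number_Theory.Gauss"
begin

text \<open>Write \<open>H = H\<^sub>1 \<dots> H\<^sub>N\<close> with \<open>H\<^sub>i = F\<^sub>i D\<^sub>i\<close>, a Fourier matrix times a diagonal matrix.

  The trace is a sum over closed paths \<open>\<kappa>\<close> in \<open>(\<int>/n)\<^sup>N\<close>. The exponents of \<open>q\<close> coming from the
  Fourier matrices add up to a quadratic form in \<open>\<kappa>\<close> that is a sum over the edges joining \<open>\<kappa>\<^sub>i\<^sub>-\<^sub>1\<close>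
  to \<open>\<kappa>\<^sub>i\<close>: the product of the ends for a letter \<open>L\<close>, half the square of their difference for \<open>R\<close>.
  The symmetric matrix of this form is \<open>Q = 2 B\<^sup>-\<^sup>1 A\<close>. To see this one multiplies by \<open>B\<close> instead of
  inverting it: a row of \<open>B\<close> adds up the entries of a vector over the block between two consecutive
  occurrences of a letter, and over such a block the edge contributions telescope
  (\<open>nzB_layer_form\<close>). In the same way \<open>\<eta>\<^sub>i\<close> is the number of letters \<open>L\<close> among \<open>\<phi>\<^sub>i, \<phi>\<^sub>i\<^sub>+\<^sub>1\<close>, and the
  last column of \<open>2 B\<^sup>-\<^sup>1\<close> is \<open>\<beta>\<close>. Since \<open>n\<close> is odd, \<open>\<kappa> = - 2 k\<close> runs over all paths when \<open>k\<close> does,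
  and under this substitution the weight of a path is the summand \<open>a\<^sub>k\<^sub>,\<^sub>m\<close>
  (\<open>summand_eq_cyclic_weight\<close>). The powers of \<open>\<theta>\<close> agree with those of the \<open>d\<^sub>i\<close> because of the
  gluing equations \<open>Q log z' + 2 log z = \<pi>\<i> \<eta>\<close> and the symmetry of \<open>Q\<close>. Representatives modulo \<open>n\<close>
  may be chosen freely, as \<open>d\<^sub>i\<^sup>n z\<^sub>i = 1\<close> and \<open>\<Prod>\<^sub>j (1 - \<zeta>\<^sup>-\<^sup>j / \<theta>\<^sub>i) = 1 - 1 / z\<^sub>i' = z\<^sub>i\<close> make the diagonal
  entries periodic.

  The determinant is multiplicative. The product of the diagonal entries of \<open>D\<^sub>i\<close> rearranges to
  \<open>z\<^sub>i\<^bsup>(n-1)/2\<^esup> \<Prod>\<^sub>j (1 - \<zeta>\<^sup>-\<^sup>j / \<theta>\<^sub>i)\<^bsup>-j\<^esup>\<close>, which is the wanted power of the cyclic dilogarithm up to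
  the factor \<open>E = exp (- \<pi>\<i> n s(- 2 a, n))\<close> (\<open>prod_cyclic_weights\<close>). The determinant of \<open>F\<^sub>L\<close> is a
  Vandermonde determinant. Each difference \<open>q\<^sup>j - q\<^sup>i\<close> is an explicit phase times
  \<open>2 sin (\<pi> a (j - i) / n)\<close>, and the sign of the sine is the parity of \<open>\<lfloor>a (j - i) / n\<rfloor>\<close>. As \<open>F\<^sub>L\<close> is
  unitary, this gives \<open>det F\<^sub>L = \<plusminus> \<i>\<^bsup>n(n-1)/2\<^esup>\<close>, the sign being the parity of the floor sum
  \<open>\<Sum>\<^sub>d (n - d) \<lfloor>a d / n\<rfloor>\<close>. The matrix \<open>F\<^sub>R\<close> is the complex conjugate of \<open>F\<^sub>L\<close> with rows and columns
  rescaled by \<open>q\<^bsup>i\<^sup>2/2\<^esup>\<close>. On the other side, \<open>n s(b, n)\<close> is an explicit rational number plus the same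
  kind of floor sum, now for \<open>b = - 2 a\<close>. The two floor sums, for \<open>a\<close> and for \<open>- 2 a\<close>, add up to
  \<open>\<lfloor>n / 4\<rfloor>\<close> modulo 2, by the reasoning of Gauss' lemma on the half system \<open>1, \<dots>, (n - 1) / 2\<close>
  (\<open>floor_sum_minus_two\<close>), and \<open>(- 1)\<^bsup>\<lfloor>n/4\<rfloor>\<^esup>\<close> is the Jacobi symbol of \<open>- 2\<close> (\<open>jacobi_minus_two\<close>).
  Altogether \<open>det F\<^sub>L = (-2/n) E\<^sup>3\<close> and \<open>det F\<^sub>R = (-2/n) E\<close>. With one more factor \<open>E\<close> from each \<open>D\<^sub>i\<close>,
  the exponent of \<open>E\<close> in \<open>det H\<close> is \<open>4 #L + 2 #R\<close>, which is what \<open>\<omega>\<close> contains.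
\<close>

section \<open>The Vandermonde determinant\<close>

text \<open>The factor \<open>T\<close> is the base change from monomials to the Newton polynomials
  \<open>\<Prod>\<^sub>l\<^sub><\<^sub>j (X - x\<^sub>l)\<close>. It is unitriangular, and it makes the Vandermonde matrix lower triangular because
  the \<open>j\<close>-th Newton polynomial vanishes at \<open>x\<^sub>i\<close> for \<open>i < j\<close>.\<close>
lemma det_vandermonde:
  fixes x :: "nat \<Rightarrow> 'a::idom"
  shows "Determinant.det (mat n n (\<lambda>(i, j). x i ^ j)) = (\<Prod>j<n. \<Prod>i<j. x j - x i)"
proof -
  define p where "p j = (\<Prod>i<j. [:- x i, 1:])" for j
  have deg_p: "Polynomial.degree (p j) = j" for j
    by (simp add: p_def degree_prod_eq_sum_degree)
  have lead_p: "lead_coeff (p j) = 1" for j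
    unfolding p_def by (subst lead_coeff_prod) simp
  define V where "V = mat n n (\<lambda>(i, j). x i ^ j)"
  define T where "T = mat n n (\<lambda>(i, j). poly.coeff (p j) i)"
  have carr: "V \<in> carrier_mat n n" "T \<in> carrier_mat n n"
    by (auto simp: V_def T_def)
  have "(V * T) $$ (i, j) = poly (p j) (x i)" if "i < n" "j < n" for i j
  proof -
    have "(V * T) $$ (i, j) = (\<Sum>l<n. x i ^ l * poly.coeff (p j) l)"
      using that by (simp add: V_def T_def scalar_prod_def lessThan_atLeast0)
    also have "\<dots> = (\<Sum>l\<le>j. poly.coeff (p j) l * x i ^ l)"
      using that deg_p by (intro sum.mono_neutral_cong_right) (auto simp: coeff_eq_0)
    finally show ?thesis by (simp add: poly_altdef deg_p)
  qed
  hence VT: "V * T = mat n n (\<lambda>(i, j). \<Prod>l<j. x i - x l)"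
    by (intro eq_matI) (auto simp: V_def T_def p_def poly_prod)
  have det_T: "Determinant.det T = 1"
  proof -
    have "upper_triangular T"
      unfolding upper_triangular_def using deg_p by (auto simp: T_def coeff_eq_0)
    hence "Determinant.det T = prod_list (diag_mat T)"
      using carr by (intro det_upper_triangular) auto
    also have "diag_mat T = map (\<lambda>_. 1) [0..<n]"
      unfolding diag_mat_def using carr lead_p deg_p by (auto simp: T_def)
    finally show ?thesis by (simp add: map_replicate_const)
  qed
  have "Determinant.det (V * T) = prod_list (diag_mat (V * T))"
    by (rule det_lower_triangular[of n]) (auto simp: VT)
  also have "\<dots> = (\<Prod>j<n. \<Prod>i<j. x j - x i)"
    by (auto simp: VT diag_mat_def prod.list_conv_set_nth lessThan_atLeast0)
  finally show ?thesis
    using carr det_T by (simp add: det_mult[of _ n] V_def)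
qed


section \<open>Half systems and the Jacobi symbol of minus two\<close>

text \<open>Multiplication by \<open>a\<close> permutes the nonzero residues modulo \<open>n\<close> up to sign, and \<open>1, \<dots>, h\<close>
  represents each of them exactly once up to sign. The map \<open>g\<close> below is the induced permutation of
  the half system.\<close>
lemma coprime_sum_half_system:
  fixes f :: "int \<Rightarrow> 'a::comm_monoid_add"
  assumes n: "n = 2 * h + 1" and cop: "coprime a n"
    and per: "\<And>k. f (k mod n) = f k"
    and ev: "\<And>k. \<not> n dvd k \<Longrightarrow> f (- k) = f k"
  shows "(\<Sum>r\<in>{1..h}. f (a * r)) = (\<Sum>r\<in>{1..h}. f r)"
proof -
  define g where "g r = (let t = (a * r) mod n in if t \<le> h then t else n - t)" for r
  have ndvd: "\<not> n dvd a * r" if "r \<in> {1..h}" for r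
    using that n cop by (auto simp: coprime_dvd_mult_right_iff coprime_commute dest!: zdvd_imp_le)
  have g_range: "g r \<in> {1..h}" if r: "r \<in> {1..h}" for r
  proof -
    have "a * r mod n \<noteq> 0" using ndvd[OF r] by (simp add: dvd_eq_mod_eq_0)
    moreover have "0 \<le> a * r mod n" "a * r mod n < n"
      using n r pos_mod_bound[of n "a * r"] by auto
    ultimately show ?thesis using n by (auto simp: g_def Let_def)
  qed
  have g_cong: "n dvd g r - a * r \<or> n dvd g r + a * r" for r
  proof (cases "a * r mod n \<le> h")
    case True
    hence "g r mod n = a * r mod n" by (simp add: g_def Let_def)
    thus ?thesis by (simp add: mod_eq_dvd_iff)
  next
    case False
    hence "(g r + a * r) mod n = 0"
      by (simp add: g_def Let_def) (metis add.commute diff_add_cancel mod_add_right_eq mod_self)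
    thus ?thesis by auto
  qed
  have f_g: "f (g r) = f (a * r)" if r: "r \<in> {1..h}" for r
    using g_cong[of r]
  proof
    assume "n dvd g r - a * r"
    hence "g r mod n = a * r mod n" by (simp add: mod_eq_dvd_iff)
    thus ?thesis using per by metis
  next
    assume "n dvd g r + a * r"
    hence "g r mod n = (- (a * r)) mod n" by (simp add: mod_eq_dvd_iff)
    hence "f (g r) = f (- (a * r))" using per by metis
    thus ?thesis using ev[OF ndvd[OF r]] by simp
  qed
  have "inj_on g {1..h}"
  proof (rule inj_onI)
    fix r s assume rs: "r \<in> {1..h}" "s \<in> {1..h}" "g r = g s"
    have "n dvd a * (r - s) \<or> n dvd a * (r + s)"
      using g_cong[of r] g_cong[of s] rs(3)
      by (smt (verit) dvd_diff dvd_minus_iff dvd_add right_diff_distrib distrib_left)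
    hence "n dvd r - s \<or> n dvd r + s"
      using cop by (simp add: coprime_dvd_mult_right_iff coprime_commute)
    moreover have "\<not> n dvd r + s"
      using rs(1,2) n by (auto dest!: zdvd_imp_le)
    moreover have "\<bar>r - s\<bar> < n" using rs(1,2) n by auto
    ultimately show "r = s"
      using dvd_imp_le_int[of "r - s" n] by (cases "r = s") auto
  qed
  moreover from this have "g ` {1..h} = {1..h}"
    using g_range by (intro endo_inj_surj) auto
  ultimately have "(\<Sum>r\<in>{1..h}. f r) = (\<Sum>r\<in>{1..h}. f (g r))"
    by (metis (no_types, lifting) comp_apply sum.cong sum.reindex)
  thus ?thesis using f_g by simp
qed

text \<open>In Gauss' lemma for the residue \<open>p - 2\<close>, which is \<open>-2\<close> modulo \<open>p\<close>, the multiples of the half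
  system reduce to the odd numbers \<open>p - 2 x\<close>, and those above \<open>(p - 1) / 2\<close> are the ones with
  \<open>x \<le> p / 4\<close>.\<close>
lemma Legendre_minus_two:
  assumes p: "prime p" "2 < p"
  shows "Legendre (- 2) (int p) = (- 1) ^ (p div 4)"
proof -
  interpret GAUSS p "int p - 2"
  proof
    show "[int p - 2 \<noteq> 0] (mod int p)"
      using p by (auto simp: cong_0_iff dest!: zdvd_imp_le)
  qed (use p in auto)
  have odd: "odd p" by (rule odd_p)
  have res: "x * (int p - 2) mod int p = int p - 2 * x" if "x \<in> A" for x
  proof -
    have "x * (int p - 2) = (int p - 2 * x) + int p * (x - 1)" by (simp add: algebra_simps)
    hence "x * (int p - 2) mod int p = (int p - 2 * x) mod int p"
      by (simp only: mod_mult_self2)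
    also have "\<dots> = int p - 2 * x"
      using that by (intro mod_pos_pos_trivial) (auto simp: A_def)
    finally show ?thesis .
  qed
  have "C = (\<lambda>x. int p - 2 * x) ` A"
    unfolding C_def B_def image_image using res by (rule image_cong[OF refl])
  hence "E = (\<lambda>x. int p - 2 * x) ` {1..int (p div 4)}"
    using odd unfolding E_def A_def by (auto simp: image_iff)
  hence "card E = p div 4"
    by (simp add: card_image inj_on_def)
  moreover have "Legendre (int p - 2) (int p) = Legendre (- 2) (int p)"
    by (simp add: Legendre_def QuadRes_def cong_def)
  ultimately show ?thesis using gauss_lemma by simp
qed

text \<open>For odd \<open>n\<close> the sign is the quadratic character modulo 8 that is 1 on the classes of 1 and 3.\<close>
lemma minus_one_power_div4_mult:
  assumes "odd m" "odd n"
  shows "(- 1 :: int) ^ (m * n div 4) = (- 1) ^ (m div 4) * (- 1) ^ (n div 4)"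
proof -
  have cases: "k mod 8 \<in> {1, 3, 5, 7}" if "odd k" for k :: nat
    using that by simp presburger
  have red: "even (k div 4) \<longleftrightarrow> k mod 8 < 4" for k :: nat by presburger
  have "even (m * n div 4) \<longleftrightarrow> even (m div 4 + n div 4)"
    using cases[OF assms(1)] cases[OF assms(2)] mod_mult_eq[of m 8 n]
    by (auto simp: red even_add)
  thus ?thesis by (metis minus_one_power_iff power_add)
qed

lemma jacobi_minus_two:
  assumes "odd n"
  shows "jacobi (- 2) n = (- 1) ^ (n div 4)"
proof -
  have pow: "(- 1 :: int) ^ (p ^ k div 4) = ((- 1) ^ (p div 4)) ^ k" if "odd p" for p k :: nat
    by (induction k) (use that in \<open>auto simp: minus_one_power_div4_mult\<close>)
  have prd: "(- 1 :: int) ^ (prod f S div 4) = (\<Prod>p\<in>S. (- 1) ^ (f p div 4))"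
    if "finite S" "\<And>p. p \<in> S \<Longrightarrow> odd (f p)" for S :: "nat set" and f :: "nat \<Rightarrow> nat"
    using that
  proof (induction S)
    case (insert p S)
    have "odd (prod f S)" using insert by (auto simp: even_prod_iff)
    thus ?case using insert by (simp add: minus_one_power_div4_mult)
  qed auto
  have odd: "odd p" if "p \<in> prime_factors n" for p
    using that assms by (meson dvd_trans in_prime_factors_imp_dvd)
  have "jacobi (- 2) n = (\<Prod>p\<in>prime_factors n. ((- 1) ^ (p div 4)) ^ multiplicity p n)"
    unfolding jacobi_def
  proof (rule prod.cong)
    fix p assume p: "p \<in> prime_factors n"
    hence "prime p" by auto
    moreover have "2 < p" using odd[OF p] prime_ge_2_nat[OF \<open>prime p\<close>] by (cases "p = 2") auto
    ultimately show "Legendre (- 2) (int p) ^ multiplicity p n = ((- 1) ^ (p div 4)) ^ multiplicity p n"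
      by (simp add: Legendre_minus_two)
  qed simp
  also have "\<dots> = (- 1) ^ ((\<Prod>p\<in>prime_factors n. p ^ multiplicity p n) div 4)"
    using odd by (subst prd) (auto simp: pow)
  also have "(\<Prod>p\<in>prime_factors n. p ^ multiplicity p n) = n"
    using prime_factorization_nat[of n] odd_pos[OF assms] by simp
  finally show ?thesis .
qed

section \<open>Floor sums and Dedekind sums\<close>

text \<open>The weight \<open>n - d\<close> is the number of pairs \<open>i < j < n\<close> with \<open>j - i = d\<close>; this is how the sum arises
  from a Vandermonde determinant. The term \<open>d = 0\<close> vanishes.\<close>
definition floor_sum :: "nat \<Rightarrow> int \<Rightarrow> int" where
  "floor_sum n b = (\<Sum>d<n. (int n - int d) * (b * int d div int n))"

lemma sum_nat_linear: "(\<Sum>d<n. real d) = real n * (real n - 1) / 2"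
  by (induction n) (auto simp: field_simps)

lemma sum_nat_square: "(\<Sum>d<n. (real d)\<^sup>2) = (real n - 1) * real n * (2 * real n - 1) / 6"
  by (induction n) (auto simp: field_simps power2_eq_square)

lemma floor_of_int_div_int: "\<lfloor>real_of_int b * real d / real n\<rfloor> = b * int d div int n"
  by (metis floor_divide_of_int_eq of_int_mult of_int_of_nat_eq)

lemma sum_reverse:
  fixes f :: "nat \<Rightarrow> 'a::comm_monoid_add"
  shows "(\<Sum>d\<in>{1..<n}. f d) = (\<Sum>d\<in>{1..<n}. f (n - d))"
  by (rule sum.reindex_bij_witness[of _ "\<lambda>d. n - d" "\<lambda>d. n - d"]) auto

lemma not_dvd_mult_coprime:
  assumes "coprime b (int n)" "d \<in> {1..<n}"
  shows "\<not> int n dvd b * int d"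
  using assms by (auto simp: coprime_dvd_mult_right_iff coprime_commute dest!: zdvd_imp_le)

lemma div_minus_of_not_dvd:
  fixes k n :: int
  assumes "n > 0" "\<not> n dvd k"
  shows "(- k) div n = - 1 - k div n"
  using assms by (simp add: div_minus_minus zdiv_zminus1_eq_if dvd_eq_mod_eq_0)

lemma div_reverse:
  assumes "coprime b (int n)" "d \<in> {1..<n}"
  shows "b * int (n - d) div int n = b - 1 - b * int d div int n"
proof -
  have "b * int (n - d) = - (b * int d) + b * int n"
    using assms by (simp add: of_nat_diff algebra_simps)
  hence "b * int (n - d) div int n = b + (- (b * int d)) div int n"
    using assms(2) div_mult_self1[of "int n" "- (b * int d)" b] by (metis atLeastLessThan_iff not_less_zero of_nat_eq_0_iff)
  thus ?thesis using assms div_minus_of_not_dvd[of "int n" "b * int d"] not_dvd_mult_coprime[OF assms]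
    by auto
qed

lemma sawtooth_frac:
  assumes "coprime b (int n)" "d \<in> {1..<n}"
  shows "sawtooth (real_of_int b * real d / real n)
       = real_of_int b * real d / real n - of_int (b * int d div int n) - 1 / 2"
proof -
  have "real_of_int b * real d / real n \<notin> \<int>"
  proof
    assume "real_of_int b * real d / real n \<in> \<int>"
    then obtain c where "real_of_int b * real d / real n = of_int c" by (auto elim: Ints_cases)
    hence "real_of_int (b * int d) = real_of_int (c * int n)" using assms by (simp add: field_simps)
    hence "b * int d = c * int n" by (simp only: of_int_eq_iff)
    thus False using not_dvd_mult_coprime[OF assms] by simp
  qed
  thus ?thesis by (simp add: sawtooth_def floor_of_int_div_int)
qed

text \<open>The sawtooth values at the multiples of \<open>b / n\<close> are antisymmetric under \<open>d \<mapsto> n - d\<close>. Hence they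
  sum to zero, which removes the constant in the first sawtooth factor, and the remaining weight \<open>d\<close>
  may be replaced by \<open>d - n\<close>.\<close>
lemma dedekind_sum_eq_floor_sum:
  assumes cop: "coprime b (int n)" and n: "n > 0"
  shows "real n * dedekind_sum b n
       = of_int b * (real n - 1) * (2 * real n - 1) / 6
         - (of_int b - 1) * real n * (real n - 1) / 2 - real n * (real n - 1) / 4
         + of_int (floor_sum n b)"
proof -
  define g where "g d = b * int d div int n" for d
  define u where "u d = of_int b * real d / real n - of_int (g d) - 1 / 2" for d
  have rev_g: "g (n - d) = b - 1 - g d" if "d \<in> {1..<n}" for d
    using div_reverse[OF cop that] by (simp add: g_def)
  have rev: "u (n - d) = - u d" if "d \<in> {1..<n}" for d
    using that n by (simp add: u_def rev_g field_simps of_nat_diff)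
  have "(\<Sum>d\<in>{1..<n}. u d) = (\<Sum>d\<in>{1..<n}. - u d)"
    by (subst sum_reverse) (intro sum.cong refl rev)
  hence u0: "(\<Sum>d\<in>{1..<n}. u d) = 0" by (simp add: sum_negf)
  have saw1: "sawtooth (real d / real n) = real d / real n - 1 / 2" if "d \<in> {1..<n}" for d
    using sawtooth_frac[of 1 n d] that by simp
  have "dedekind_sum b n = (\<Sum>d\<in>{1..<n}. (real d / real n - 1 / 2) * u d)"
    unfolding dedekind_sum_def
    by (intro sum.cong refl) (simp add: saw1 sawtooth_frac[OF cop] u_def g_def)
  also have "\<dots> = (\<Sum>d\<in>{1..<n}. real d * u d) / real n - (\<Sum>d\<in>{1..<n}. u d) / 2"
    by (simp add: sum_divide_distrib sum_subtractf[symmetric] algebra_simps)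
  finally have "real n * dedekind_sum b n = (\<Sum>d\<in>{1..<n}. real d * u d)"
    using u0 n by simp
  also have "\<dots> = (\<Sum>d\<in>{1..<n}. (real n - real d) * (- u d))"
    by (subst sum_reverse) (auto intro!: sum.cong simp: rev of_nat_diff)
  also have "\<dots> = (\<Sum>d\<in>{1..<n}. (real d - real n) * (of_int b * real d / real n - 1 / 2)
                      + (real n - real d) * of_int (g d))"
  proof (intro sum.cong refl)
    have "(N - D) * - (X - G - 1 / 2) = (D - N) * (X - 1 / 2) + (N - D) * G" for N D X G :: real
      by (simp add: field_simps)
    thus "(real n - real d) * - u d = (real d - real n) * (of_int b * real d / real n - 1 / 2)
            + (real n - real d) * of_int (g d)" for d
      unfolding u_def .
  qed
  also have "\<dots> = (\<Sum>d\<in>{1..<n}. (real d - real n) * (of_int b * real d / real n - 1 / 2))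
                   + (\<Sum>d\<in>{1..<n}. (real n - real d) * of_int (g d))"
    by (rule sum.distrib)
  also have "(\<Sum>d\<in>{1..<n}. (real n - real d) * of_int (g d)) = of_int (floor_sum n b)"
    unfolding floor_sum_def of_int_sum g_def
    by (rule sum.mono_neutral_cong_left) (auto simp: not_less_eq_eq)
  also have "(\<Sum>d\<in>{1..<n}. (real d - real n) * (of_int b * real d / real n - 1 / 2))
     = (\<Sum>d<n. (real d - real n) * (of_int b * real d / real n - 1 / 2)) - real n / 2"
  proof -
    have "{..<n} = insert 0 {1..<n}" using n by auto
    thus ?thesis by simp
  qed
  also have "(\<Sum>d<n. (real d - real n) * (of_int b * real d / real n - 1 / 2))
     = (\<Sum>d<n. of_int b / real n * (real d)\<^sup>2 - (of_int b + 1 / 2) * real d + real n / 2)"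
    using n by (intro sum.cong refl) (simp add: field_simps power2_eq_square)
  also have "\<dots> = of_int b / real n * (\<Sum>d<n. (real d)\<^sup>2) - (of_int b + 1 / 2) * (\<Sum>d<n. real d)
                   + real n * (real n / 2)"
    by (simp add: sum.distrib sum_subtractf sum_distrib_left)
  finally have "real n * dedekind_sum b n
    = of_int b / real n * ((real n - 1) * real n * (2 * real n - 1) / 6)
      - (of_int b + 1 / 2) * (real n * (real n - 1) / 2) + real n * (real n / 2) - real n / 2
      + of_int (floor_sum n b)"
    unfolding sum_nat_linear sum_nat_square .
  moreover have "of_int b / real n * ((real n - 1) * real n * (2 * real n - 1) / 6)
    = of_int b * (real n - 1) * (2 * real n - 1) / 6"
    using n by simp
  ultimately have "real n * dedekind_sum b n
    = of_int b * (real n - 1) * (2 * real n - 1) / 6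
      - (of_int b + 1 / 2) * (real n * (real n - 1) / 2) + real n * (real n / 2) - real n / 2
      + of_int (floor_sum n b)"
    by (simp only:)
  thus ?thesis by (simp add: field_simps)
qed

lemma sum_even_lessThan:
  fixes f :: "nat \<Rightarrow> 'a::comm_monoid_add"
  shows "(\<Sum>d | d < 2 * h + 1 \<and> even d. f d) = (\<Sum>r\<le>h. f (2 * r))"
  by (rule sum.reindex_bij_witness[of _ "\<lambda>r. 2 * r" "\<lambda>d. d div 2"]) auto

text \<open>For odd \<open>n\<close> the weight \<open>n - d\<close> is odd exactly when \<open>d\<close> is even, so only the even \<open>d = 2 r\<close> matter
  modulo 2.\<close>
lemma floor_sum_parity:
  assumes n: "n = 2 * h + 1"
  shows "even (floor_sum n b) \<longleftrightarrow> even (\<Sum>r\<in>{1..int h}. 2 * b * r div int n)"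
proof -
  have "floor_sum n b - (\<Sum>d | d < n \<and> even d. b * int d div int n)
     = (\<Sum>d<n. (int n - int d) * (b * int d div int n)
            - (if even d then b * int d div int n else 0))"
    by (simp add: floor_sum_def sum_subtractf sum.If_cases Int_def)
  also have "even \<dots>"
  proof (rule dvd_sum)
    fix d
    show "even ((int n - int d) * (b * int d div int n) - (if even d then b * int d div int n else 0))"
      using n by (cases "even d") simp_all
  qed
  finally have "even (floor_sum n b) \<longleftrightarrow> even (\<Sum>d | d < n \<and> even d. b * int d div int n)"
    by simp
  also have "(\<Sum>d | d < n \<and> even d. b * int d div int n) = (\<Sum>r\<le>h. b * int (2 * r) div int n)"
    unfolding n by (rule sum_even_lessThan)
  also have "\<dots> = (\<Sum>r\<in>{1..h}. b * int (2 * r) div int n)"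
    by (rule sum.mono_neutral_right) (auto simp: not_less_eq_eq)
  also have "\<dots> = (\<Sum>r\<in>{1..int h}. 2 * b * r div int n)"
    by (rule sum.reindex_bij_witness[of _ nat int]) (auto simp: ac_simps)
  finally show ?thesis .
qed

text \<open>Modulo 2 both floor sums are sums over the half system, and together they sum \<open>f (a r)\<close> for
  the function \<open>f\<close> below. Combining the multipliers \<open>-4\<close> and \<open>2\<close> makes \<open>f\<close> both periodic and even modulo 2;
  so \<open>a\<close> can be dropped, and \<open>f r\<close> is odd exactly for \<open>r < n / 4\<close>.\<close>
lemma floor_sum_minus_two:
  assumes "odd n" and cop: "coprime a (int n)"
  shows "even (floor_sum n (- 2 * a) + floor_sum n a + int (n div 4))"
proof -
  obtain h where n: "n = 2 * h + 1" using \<open>odd n\<close> by (auto elim: oddE)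
  define f :: "int \<Rightarrow> int" where "f k = (- 4 * k) div int n + (2 * k) div int n" for k
  have f_per: "f (k mod int n) mod 2 = f k mod 2" for k
  proof -
    define c where "c = k div int n"
    have k: "k = k mod int n + c * int n" by (simp add: c_def)
    have shift: "(x + y * int n) div int n = x div int n + y" for x y
      using n by simp
    have "- 4 * k = - 4 * (k mod int n) + (- 4 * c) * int n"
         "2 * k = 2 * (k mod int n) + (2 * c) * int n"
      by (subst k, simp add: algebra_simps)+
    hence "(- 4 * k) div int n = (- 4 * (k mod int n)) div int n + - 4 * c"
          "(2 * k) div int n = (2 * (k mod int n)) div int n + 2 * c"
      by (simp_all only: shift)
    hence "f k = f (k mod int n) + 2 * (- c)" by (simp add: f_def)
    thus ?thesis by (simp only: mod_mult_self2)
  qed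
  have f_even: "f (- k) mod 2 = f k mod 2" if "\<not> int n dvd k" for k
  proof -
    have dvd2: "int n dvd 2 * x \<longleftrightarrow> int n dvd x" for x
      using \<open>odd n\<close> by (intro coprime_dvd_mult_right_iff) simp
    hence "\<not> int n dvd 2 * k" "\<not> int n dvd 2 * (2 * k)"
      using that by blast+
    hence "(- (2 * k)) div int n = - 1 - 2 * k div int n"
          "(- (- 4 * k)) div int n = - 1 - (- 4 * k) div int n"
      using n div_minus_of_not_dvd[of "int n" "2 * k"] div_minus_of_not_dvd[of "int n" "4 * k"]
      by (simp_all add: mult.assoc[symmetric])
    hence "f (- k) = 2 * (- 1 - f k) + f k" by (simp add: f_def)
    thus ?thesis by (simp only: mod_mult_self4)
  qed
  have "(\<Sum>r\<in>{1..int h}. f (a * r) mod 2) = (\<Sum>r\<in>{1..int h}. f r mod 2)"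
    by (rule coprime_sum_half_system[where n = "int n"]) (use n cop f_per f_even in auto)
  moreover have "(\<Sum>r\<in>{1..int h}. f r mod 2) = int (n div 4)"
  proof -
    have "f r mod 2 = (if 4 * r < int n then 1 else 0)" if "r \<in> {1..int h}" for r
    proof -
      have "2 * r div int n = 0" using that n by (simp add: div_pos_pos_trivial)
      moreover have "- 4 * r div int n = (if 4 * r < int n then - 1 else - 2)"
      proof (cases "4 * r < int n")
        case True
        hence "- 4 * r div int n = - 1"
          using that by (intro int_div_pos_eq[where r = "int n - 4 * r"]) auto
        thus ?thesis using True by simp
      next
        case False
        moreover have "4 * r \<noteq> int n" using \<open>odd n\<close> by presburger
        ultimately have "- 4 * r div int n = - 2"
          using that n by (intro int_div_pos_eq[where r = "2 * int n - 4 * r"]) auto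
        thus ?thesis using False by simp
      qed
      ultimately show ?thesis by (simp add: f_def)
    qed
    hence "(\<Sum>r\<in>{1..int h}. f r mod 2) = (\<Sum>r\<in>{1..int h}. if 4 * r < int n then 1 else 0)"
      by simp
    also have "\<dots> = int (card {r\<in>{1..int h}. 4 * r < int n})"
      by (simp add: sum.If_cases Int_def)
    also have "{r\<in>{1..int h}. 4 * r < int n} = {1..int (n div 4)}"
    proof -
      have "4 * r < m \<longleftrightarrow> r \<le> m div 4" if "odd m" for m r :: int
        using that by presburger
      hence "4 * r < int n \<longleftrightarrow> r \<le> int n div 4" for r
        using \<open>odd n\<close> by (metis even_of_nat_iff)
      moreover have "r \<le> int h" if "4 * r < int n" for r
        using that n by linarith
      ultimately show ?thesis by (auto simp: zdiv_int)
    qed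
    finally show ?thesis by simp
  qed
  moreover have "even (\<Sum>r\<in>{1..int h}. f (a * r)) \<longleftrightarrow> even (\<Sum>r\<in>{1..int h}. f (a * r) mod 2)"
    unfolding even_iff_mod_2_eq_zero by (simp only: mod_sum_eq)
  moreover have "(\<Sum>r\<in>{1..int h}. f (a * r))
      = (\<Sum>r\<in>{1..int h}. 2 * (- 2 * a) * r div int n) + (\<Sum>r\<in>{1..int h}. 2 * a * r div int n)"
    by (simp add: f_def sum.distrib ac_simps)
  ultimately show ?thesis
    using floor_sum_parity[OF n, of a] floor_sum_parity[OF n, of "- 2 * a"] by simp
qed

definition floor_sign :: "nat \<Rightarrow> int \<Rightarrow> complex" where
  "floor_sign n b = (- 1) powi floor_sum n b"

lemma minus_one_powi: "(- 1 :: complex) powi k = (if even k then 1 else - 1)"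
  by (simp add: power_int_minus_left)

lemma minus_one_powi_sum: "finite A \<Longrightarrow> (- 1 :: complex) powi (\<Sum>x\<in>A. f x) = (\<Prod>x\<in>A. (- 1) powi f x)"
  by (induction A rule: finite_induct) (auto simp: power_int_add)

lemma floor_sign_sq [simp]: "floor_sign n b * floor_sign n b = 1"
  by (simp add: floor_sign_def minus_one_powi)

lemma of_int_jacobi_minus_two:
  assumes "odd n" "coprime a (int n)"
  shows "of_int (jacobi (- 2) n) = floor_sign n (- 2 * a) * floor_sign n a"
proof -
  have "even (floor_sum n (- 2 * a) + floor_sum n a) \<longleftrightarrow> even (n div 4)"
    using floor_sum_minus_two[OF assms] by simp
  thus ?thesis
    unfolding jacobi_minus_two[OF assms(1)] floor_sign_def
    by (auto simp: minus_one_powi minus_one_power_iff)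
qed

lemma exp_minus_one_power: "exp (\<i> * pi * of_int k) = (- 1) powi k"
  by (metis exp_power_int exp_pi_i' mult.commute)

text \<open>For \<open>b = - 2 a\<close> the term \<open>- (b - 1) n (n - 1) / 2\<close> of \<open>n s(b, n)\<close> splits into an even integer and
  \<open>n (n - 1) / 2\<close>; the latter turns the quarter \<open>- n (n - 1) / 4\<close> into \<open>n (n - 1) / 4\<close>.\<close>
lemma exp_dedekind_sum:
  assumes "odd n" and cop: "coprime a (int n)"
  shows "exp (- \<i> * pi * of_real (real n * dedekind_sum (- 2 * a) n))
       = floor_sign n (- 2 * a)
         * exp (2 * pi * \<i> * of_real (of_int a * (real n - 1) * (2 * real n - 1) / 6))
         * exp (- \<i> * pi * of_real (real n * (real n - 1) / 4))"
proof -
  have n: "n > 0" using \<open>odd n\<close> by (rule odd_pos)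
  have cop2: "coprime (- 2 * a) (int n)"
    using cop \<open>odd n\<close> by simp
  obtain h where h: "n = 2 * h + 1" using \<open>odd n\<close> by (auto elim: oddE)
  define F where "F = floor_sum n (- 2 * a)"
  have "real n * dedekind_sum (- 2 * a) n
     = - (of_int a * (real n - 1) * (2 * real n - 1) / 3)
       + real n * (real n - 1) / 4 + (of_int F + of_int (a * int n * (2 * int h)))"
    unfolding dedekind_sum_eq_floor_sum[OF cop2 n] F_def using h by (simp add: field_simps)
  note eq = this
  have "- \<i> * pi * of_real (real n * dedekind_sum (- 2 * a) n)
     = 2 * pi * \<i> * of_real (of_int a * (real n - 1) * (2 * real n - 1) / 6)
       + - \<i> * pi * of_real (real n * (real n - 1) / 4)
       + \<i> * pi * of_int (- F - a * int n * (2 * int h))"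
    unfolding eq by (simp add: field_simps)
  hence "exp (- \<i> * pi * of_real (real n * dedekind_sum (- 2 * a) n))
     = exp (2 * pi * \<i> * of_real (of_int a * (real n - 1) * (2 * real n - 1) / 6))
       * exp (- \<i> * pi * of_real (real n * (real n - 1) / 4))
       * exp (\<i> * pi * of_int (- F - a * int n * (2 * int h)))"
    by (simp only: exp_add)
  also have "exp (\<i> * pi * of_int (- F - a * int n * (2 * int h))) = floor_sign n (- 2 * a)"
    unfolding exp_minus_one_power floor_sign_def by (simp add: minus_one_powi F_def)
  finally show ?thesis by (simp add: mult_ac)
qed


section \<open>Determinants of the Fourier matrices\<close>

lemma sin_pi_floor_sign:
  assumes "n > 0"
  shows "complex_of_real (sin (pi * of_int k / real n))
       = (- 1) powi (k div int n) * of_real \<bar>sin (pi * of_int k / real n)\<bar>"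
proof -
  define r where "r = real_of_int (k mod int n) / real n"
  have r: "0 \<le> r" "r \<le> 1"
    using assms by (auto simp: r_def divide_le_eq intro!: less_imp_le of_int_less_iff[THEN iffD2, of _ "int n", simplified])
  have "real_of_int k = real n * of_int (k div int n) + of_int (k mod int n)"
    by (metis mult_div_mod_eq of_int_add of_int_mult of_int_of_nat_eq)
  hence "pi * of_int k / real n = pi * r + of_int (k div int n) * pi"
    using assms by (simp add: r_def field_simps)
  hence "sin (pi * of_int k / real n) = sin (pi * r) * cos (of_int (k div int n) * pi)"
    by (simp add: sin_add sin_times_pi_eq_0)
  moreover have "cos (of_int (k div int n) * pi) = (if even (k div int n) then 1 else - 1)"
    by (simp add: cos_npi_int mult.commute)
  moreover have "sin (pi * r) \<ge> 0" using r by (intro sin_ge_zero) auto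
  ultimately show ?thesis by (simp add: minus_one_powi)
qed

lemma exp_difference_eq_sin:
  "exp (\<i> * of_real x) - exp (\<i> * of_real y)
     = exp (\<i> * of_real ((x + y) / 2)) * (2 * \<i> * of_real (sin ((x - y) / 2)))"
proof -
  have "2 * \<i> * of_real (sin t) = exp (\<i> * of_real t) - exp (- (\<i> * of_real t))" for t :: real
    unfolding sin_of_real[symmetric] by (simp add: sin_exp_eq)
  moreover have "\<i> * of_real x = \<i> * of_real ((x + y) / 2) + \<i> * of_real ((x - y) / 2)"
    "\<i> * of_real y = \<i> * of_real ((x + y) / 2) + - (\<i> * of_real ((x - y) / 2))"
    by (simp_all add: field_simps)
  ultimately show ?thesis by (metis exp_add right_diff_distrib)
qed

text \<open>There are \<open>n - d\<close> pairs \<open>i < j < n\<close> with difference \<open>d\<close>.\<close>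
lemma prod_triangle_difference:
  fixes f :: "nat \<Rightarrow> 'a::comm_monoid_mult"
  shows "(\<Prod>j<n. \<Prod>i<j. f (j - i)) = (\<Prod>d\<in>{1..<n}. f d ^ (n - d))"
proof (induction n)
  case (Suc n)
  have "(\<Prod>i<n. f (n - i)) = (\<Prod>d\<in>{1..n}. f d)"
    by (rule prod.reindex_bij_witness[of _ "\<lambda>d. n - d" "\<lambda>i. n - i"]) auto
  moreover have "(\<Prod>d\<in>{1..<n}. f d ^ (n - d)) = (\<Prod>d\<in>{1..n}. f d ^ (n - d))"
    by (rule prod.mono_neutral_left) (auto simp: not_less_eq_eq)
  moreover have "(\<Prod>d\<in>{1..<Suc n}. f d ^ (Suc n - d)) = (\<Prod>d\<in>{1..n}. f d ^ (n - d) * f d)"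
    by (intro prod.cong) (auto simp: Suc_diff_le mult.commute)
  ultimately show ?case using Suc by (simp add: prod.distrib)
qed simp

definition root_exp :: "nat \<Rightarrow> int \<Rightarrow> complex" where
  "root_exp n a = exp (2 * pi * \<i> * of_int a / of_nat n)"

lemma root_exp_powi: "root_exp n a powi k = exp (2 * pi * \<i> * of_int (a * k) / of_nat n)"
  unfolding root_exp_def by (simp add: exp_power_int field_simps)

lemma root_exp_minus: "root_exp n (- a) = inverse (root_exp n a)"
  by (simp add: root_exp_def exp_minus)

lemma root_exp_power_n: "n > 0 \<Longrightarrow> root_exp n a ^ n = 1"
  using root_exp_powi[of n a "int n"] exp_integer_2pi[of "of_int a"] by (simp add: mult_ac)

lemma root_exp_powi_eq_1_iff:
  assumes "n > 0" "coprime a (int n)"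
  shows "root_exp n a powi k = 1 \<longleftrightarrow> int n dvd k"
proof -
  have "root_exp n a powi k = 1 \<longleftrightarrow> (\<exists>c::int. real_of_int (a * k) = of_int (c * int n))"
    using assms unfolding root_exp_powi exp_eq_1 by (simp add: field_simps)
  also have "\<dots> \<longleftrightarrow> int n dvd a * k" by (simp only: of_int_eq_iff dvd_def mult.commute)
  finally show ?thesis using assms by (simp add: coprime_dvd_mult_right_iff coprime_commute)
qed

lemma sum_plus_below_triangle:
  "(\<Sum>j<n. \<Sum>i<j. real i + real j) = real n * (real n - 1)\<^sup>2 / 2"
proof (induction n)
  case (Suc n)
  have "(\<Sum>i<n. real i + real n) = real n * (real n - 1) / 2 + real n * real n"
    by (simp add: sum.distrib sum_nat_linear)
  thus ?case using Suc by (simp add: field_simps power2_eq_square)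
qed simp

definition det_fourier_L :: "nat \<Rightarrow> int \<Rightarrow> complex" where
  "det_fourier_L n a = Determinant.det (fourier_factor n (root_exp n a) L)"

text \<open>The exponential factors of the differences \<open>q\<^sup>j - q\<^sup>i\<close> multiply to \<open>exp (\<pi>\<i> a (n - 1)\<^sup>2 / 2)\<close>, which
  is 1 for odd \<open>n\<close>; there remain one factor \<open>\<i>\<close> for each pair and the signs of the sines.\<close>
lemma det_fourier_L_phase:
  assumes "odd n" and cop: "coprime a (int n)"
  shows "\<exists>\<rho>>0. det_fourier_L n a = of_real \<rho> * (floor_sign n a * exp (\<i> * pi * of_real (real n * (real n - 1) / 4)))"
proof -
  have n: "n > 0" using \<open>odd n\<close> by (rule odd_pos)
  define t where "t k = pi * of_int (a * k) / real n" for k :: int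
  define c where "c d = (- 1 :: complex) powi (a * int d div int n)" for d :: nat
  define r where "r d = 2 * \<bar>sin (t (int d))\<bar>" for d :: nat
  have cop': "root_exp n a powi k \<noteq> 1" if "\<not> int n dvd k" for k
    using root_exp_powi_eq_1_iff[OF n cop] that by blast
  have diff: "root_exp n a ^ j - root_exp n a ^ i
      = exp (\<i> * pi * of_real (of_int a / real n * (real i + real j)))
        * (\<i> * c (j - i) * of_real (r (j - i)))" if "i < j" for i j
  proof -
    have e: "root_exp n a ^ k = exp (\<i> * of_real (2 * t (int k)))" for k
      using root_exp_powi[of n a "int k"] by (simp add: t_def field_simps)
    have mean: "(2 * t (int j) + 2 * t (int i)) / 2 = pi * (of_int a / real n * (real i + real j))"
      and half: "(2 * t (int j) - 2 * t (int i)) / 2 = t (int (j - i))"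
      using that n by (simp_all add: t_def field_simps of_nat_diff)
    have sgn: "complex_of_real (sin (t (int (j - i)))) = c (j - i) * of_real \<bar>sin (t (int (j - i)))\<bar>"
      unfolding t_def c_def by (rule sin_pi_floor_sign[OF n])
    have "root_exp n a ^ j - root_exp n a ^ i
        = exp (\<i> * of_real (pi * (of_int a / real n * (real i + real j))))
          * (2 * \<i> * of_real (sin (t (int (j - i)))))"
      by (simp only: e exp_difference_eq_sin mean half)
    thus ?thesis
      by (subst (asm) sgn) (simp add: r_def mult_ac)
  qed
  define \<rho>1 where "\<rho>1 = (\<Prod>j<n. \<Prod>i<j. r (j - i))"
  have "Determinant.det (mat n n (\<lambda>(i, j). (root_exp n a ^ i) ^ j))
      = (\<Prod>j<n. \<Prod>i<j. exp (\<i> * pi * of_real (of_int a / real n * (real i + real j)))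
           * (\<i> * c (j - i) * of_real (r (j - i))))"
    unfolding det_vandermonde by (intro prod.cong refl diff) auto
  also have "\<dots> = exp (\<Sum>j<n. \<Sum>i<j. \<i> * pi * of_real (of_int a / real n * (real i + real j)))
       * \<i> ^ (\<Sum>j<n. j) * (\<Prod>j<n. \<Prod>i<j. c (j - i)) * of_real \<rho>1"
    by (simp add: prod.distrib exp_sum power_sum \<rho>1_def mult_ac)
  also have "(\<Sum>j<n. \<Sum>i<j. \<i> * pi * of_real (of_int a / real n * (real i + real j)))
     = \<i> * pi * of_real (of_int a / real n * (\<Sum>j<n. \<Sum>i<j. real i + real j))"
    by (simp only: sum_distrib_left of_real_sum of_real_mult)
  also have "of_int a / real n * (\<Sum>j<n. \<Sum>i<j. real i + real j) = of_int a * (real n - 1)\<^sup>2 / 2"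
    using n by (simp add: sum_plus_below_triangle)
  also have "exp (\<i> * pi * of_real (of_int a * (real n - 1)\<^sup>2 / 2)) = 1"
  proof -
    obtain h where h: "n = 2 * h + 1" using \<open>odd n\<close> by (auto elim: oddE)
    have "\<i> * pi * of_real (of_int a * (real n - 1)\<^sup>2 / 2) = \<i> * pi * of_int (2 * a * int h * int h)"
      by (simp add: h power2_eq_square)
    thus ?thesis by (simp only: exp_minus_one_power minus_one_powi) simp
  qed
  also have "\<i> ^ (\<Sum>j<n. j) = exp (\<i> * pi * of_real (real n * (real n - 1) / 4))"
  proof -
    have pow: "\<i> ^ k = exp (\<i> * pi * of_real (real k / 2))" for k
    proof -
      have "exp (of_nat k * (\<i> * pi / 2)) = exp (\<i> * pi / 2) ^ k" by (rule exp_of_nat_mult)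
      moreover have "exp (\<i> * pi / 2) = \<i>"
        using cis_pi_half by (simp add: cis_conv_exp)
      ultimately show ?thesis by (simp add: mult_ac)
    qed
    have idx: "real (\<Sum>j<n. j) = real n * (real n - 1) / 2"
      by (simp add: sum_nat_linear)
    show ?thesis unfolding pow idx by simp
  qed
  also have "(\<Prod>j<n. \<Prod>i<j. c (j - i)) = floor_sign n a"
  proof -
    have "(\<Prod>j<n. \<Prod>i<j. c (j - i)) = (\<Prod>d\<in>{1..<n}. (- 1) powi ((int n - int d) * (a * int d div int n)))"
      unfolding prod_triangle_difference
      by (intro prod.cong refl) (auto simp: c_def minus_one_powi minus_one_power_iff even_diff)
    also have "\<dots> = (\<Prod>d<n. (- 1) powi ((int n - int d) * (a * int d div int n)))"
      by (rule prod.mono_neutral_left) (auto simp: not_less_eq_eq)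
    also have "\<dots> = (- 1) powi floor_sum n a"
      unfolding floor_sum_def by (rule minus_one_powi_sum[symmetric]) simp
    finally show ?thesis by (simp add: floor_sign_def)
  qed
  finally have van: "Determinant.det (mat n n (\<lambda>(i, j). (root_exp n a ^ i) ^ j))
      = of_real \<rho>1 * (floor_sign n a * exp (\<i> * pi * of_real (real n * (real n - 1) / 4)))"
    by (simp add: mult_ac)
  have "\<rho>1 > 0"
    unfolding \<rho>1_def
  proof (intro prod_pos ballI)
    fix j i assume "j \<in> {..<n}" "i \<in> {..<j}"
    hence "\<not> int n dvd int j - int i" by (auto dest!: zdvd_imp_le)
    hence "root_exp n a powi (int j - int i) \<noteq> 1" by (rule cop')
    hence "root_exp n a ^ j \<noteq> root_exp n a ^ i"
      by (auto simp: power_int_diff root_exp_def)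
    thus "0 < r (j - i)" using diff[of i j] \<open>i \<in> {..<j}\<close> by (auto simp: r_def)
  qed
  moreover have "fourier_factor n (root_exp n a) L
      = of_real (1 / sqrt (real n)) \<cdot>\<^sub>m mat n n (\<lambda>(i, j). (root_exp n a ^ i) ^ j)"
    by (rule eq_matI) (auto simp: fourier_factor_def power_mult simp flip: of_nat_mult)
  hence "det_fourier_L n a = of_real ((1 / sqrt (real n)) ^ n * \<rho>1)
      * (floor_sign n a * exp (\<i> * pi * of_real (real n * (real n - 1) / 4)))"
    by (simp add: det_fourier_L_def van power_divide)
  moreover have "(1 / sqrt (real n)) ^ n > 0" using n by simp
  ultimately show ?thesis by (metis mult_pos_pos)
qed

lemma fourier_factor_L_inverse:
  assumes n: "n > 0" and cop: "coprime a (int n)"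
  shows "fourier_factor n (root_exp n a) L * fourier_factor n (root_exp n (- a)) L = 1\<^sub>m n"
proof (rule eq_matI)
  fix i j assume "i < dim_row (1\<^sub>m n :: complex mat)" "j < dim_col (1\<^sub>m n :: complex mat)"
  hence ij: "i < n" "j < n" by auto
  define x where "x = root_exp n a powi (int i - int j)"
  have [simp]: "root_exp n a \<noteq> 0" by (simp add: root_exp_def)
  have sq: "complex_of_real (1 / sqrt (real n)) * of_real (1 / sqrt (real n)) = 1 / of_nat n"
    unfolding of_real_mult[symmetric] using n by (simp add: field_simps)
  have "(fourier_factor n (root_exp n a) L * fourier_factor n (root_exp n (- a)) L) $$ (i, j)
     = (\<Sum>l<n. (of_real (1 / sqrt (real n)) * of_real (1 / sqrt (real n)))
          * (root_exp n a powi (int i * int l) * root_exp n (- a) powi (int l * int j)))"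
    using ij by (simp add: fourier_factor_def scalar_prod_def lessThan_atLeast0 mult_ac)
  also have "\<dots> = (\<Sum>l<n. x ^ l) / of_nat n"
    unfolding sq root_exp_minus power_int_inverse sum_divide_distrib
    by (intro sum.cong refl)
       (simp add: x_def power_int_diff power_divide power_int_mult divide_simps mult.commute[of "int _" "int j"])
  also have "\<dots> = (if i = j then 1 else 0)"
  proof (cases "i = j")
    case False
    hence "\<not> int n dvd int i - int j" using ij dvd_imp_le_int[of "int i - int j" "int n"] by auto
    hence "x \<noteq> 1" unfolding x_def by (simp add: root_exp_powi_eq_1_iff[OF n cop])
    moreover have "x ^ n = (root_exp n a ^ n) powi (int i - int j)"
      unfolding x_def by (metis mult.commute power_int_mult power_int_of_nat)
    ultimately show ?thesis using False by (simp add: geometric_sum root_exp_power_n[OF n])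
  qed (use n in \<open>simp add: x_def\<close>)
  finally show "(fourier_factor n (root_exp n a) L * fourier_factor n (root_exp n (- a)) L) $$ (i, j)
     = 1\<^sub>m n $$ (i, j)"
    using ij by simp
qed (auto simp: fourier_factor_def)

lemma det_fourier_L_mult_minus:
  assumes "n > 0" "coprime a (int n)"
  shows "det_fourier_L n a * det_fourier_L n (- a) = 1"
proof -
  have "det_fourier_L n a * det_fourier_L n (- a)
     = Determinant.det (fourier_factor n (root_exp n a) L * fourier_factor n (root_exp n (- a)) L)"
    unfolding det_fourier_L_def by (rule det_mult[symmetric, of _ n]) (auto simp: fourier_factor_def)
  thus ?thesis by (simp add: fourier_factor_L_inverse assms)
qed

lemma det_fourier_L_minus: "det_fourier_L n (- a) = cnj (det_fourier_L n a)"
proof -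
  interpret comm_ring_hom cnj by unfold_locales auto
  have "cnj (root_exp n a) = root_exp n (- a)"
    by (simp add: root_exp_def exp_cnj)
  hence "fourier_factor n (root_exp n (- a)) L = map_mat cnj (fourier_factor n (root_exp n a) L)"
    by (intro eq_matI) (auto simp: fourier_factor_def power_int_def)
  thus ?thesis by (simp add: det_fourier_L_def)
qed

text \<open>The modulus is 1 because the matrix is unitary, so its phase determines the determinant.\<close>
lemma det_fourier_L_eq:
  assumes "odd n" and cop: "coprime a (int n)"
  shows "det_fourier_L n a = floor_sign n a * exp (\<i> * pi * of_real (real n * (real n - 1) / 4))"
proof -
  have n: "n > 0" using \<open>odd n\<close> by (rule odd_pos)
  obtain \<rho> where \<rho>: "\<rho> > 0"
    "det_fourier_L n a = of_real \<rho> * (floor_sign n a * exp (\<i> * pi * of_real (real n * (real n - 1) / 4)))"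
    using det_fourier_L_phase[OF assms] by auto
  have "(norm (det_fourier_L n a))\<^sup>2 = 1"
    using det_fourier_L_mult_minus[OF n cop]
    unfolding det_fourier_L_minus complex_norm_square[symmetric] by (simp only: of_real_eq_1_iff)
  hence "norm (det_fourier_L n a) = 1" by (smt (verit) norm_ge_zero power2_eq_1_iff)
  moreover have "norm (exp (\<i> * pi * of_real (real n * (real n - 1) / 4))) = 1"
    using norm_exp_i_times[of "pi * (real n * (real n - 1) / 4)"] by (simp add: mult.assoc)
  moreover have "norm (floor_sign n a) = 1" by (simp add: floor_sign_def minus_one_powi)
  ultimately have "\<rho> = 1" using \<rho> by (simp add: norm_mult)
  thus ?thesis using \<rho> by simp
qed

lemma det_mat_diag: "Determinant.det (mat_diag n f) = (\<Prod>i<n. f i)"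
proof -
  have "Determinant.det (mat_diag n f) = prod_list (diag_mat (mat_diag n f))"
    by (rule det_upper_triangular[of _ n]) (auto simp: mat_diag_def)
  thus ?thesis
    by (simp add: diag_mat_def mat_diag_def prod.list_conv_set_nth lessThan_atLeast0)
qed

lemma two_inv2: "odd n \<Longrightarrow> 2 * inv2 n = int n + 1"
  by (auto simp: inv2_def elim!: oddE)

text \<open>From \<open>(i - j)\<^sup>2 / 2 = i\<^sup>2 / 2 + j\<^sup>2 / 2 - i j\<close>, where half means multiplication by the inverse of 2
  modulo \<open>n\<close>.\<close>
lemma det_fourier_R:
  assumes "odd n" and cop: "coprime a (int n)"
  shows "Determinant.det (fourier_factor n (root_exp n a) R)
       = exp (2 * pi * \<i> * of_real (of_int a * (real n - 1) * (2 * real n - 1) / 6)) * det_fourier_L n (- a)"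
proof -
  have n: "n > 0" using \<open>odd n\<close> by (rule odd_pos)
  define q where "q = root_exp n a"
  have q0: "q \<noteq> 0" by (simp add: q_def root_exp_def)
  have qn: "q powi (int n * k) = 1" for k
    using root_exp_power_n[OF n, of a] by (simp add: q_def power_int_mult)
  have add: "q powi (k + l) = q powi k * q powi l" for k l
    using q0 by (simp add: power_int_add)
  have "(int n + 1) * k = k + int n * k" for k by (simp add: algebra_simps)
  hence half: "q powi (2 * inv2 n * k) = q powi k" for k
    unfolding two_inv2[OF \<open>odd n\<close>] using q0 qn by (simp add: power_int_add)
  define D where "D = mat_diag n (\<lambda>i. q powi (inv2 n * (int i)\<^sup>2))"
  define F where "F = fourier_factor n (root_exp n (- a)) L"
  have carr: "F \<in> carrier_mat n n" "D \<in> carrier_mat n n"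
    by (auto simp: F_def D_def fourier_factor_def)
  hence "D * F \<in> carrier_mat n n" by simp
  note carr = carr this
  have "fourier_factor n q R = D * F * D"
  proof (rule eq_matI)
    fix i j assume "i < dim_row (D * F * D)" "j < dim_col (D * F * D)"
    hence ij: "i < n" "j < n" using carr by auto
    have expand: "inv2 n * (int i - int j)\<^sup>2
       = inv2 n * (int i)\<^sup>2 + inv2 n * (int j)\<^sup>2 + 2 * inv2 n * (- (int i * int j))"
      by (simp add: power2_eq_square algebra_simps)
    have "q powi (inv2 n * (int i - int j)\<^sup>2)
        = q powi (inv2 n * (int i)\<^sup>2) * q powi (inv2 n * (int j)\<^sup>2) * q powi (- (int i * int j))"
      by (simp only: expand add half)
    moreover have "(D * F * D) $$ (i, j) = q powi (inv2 n * (int i)\<^sup>2)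
        * (of_real (1 / sqrt (real n)) * root_exp n (- a) powi (int i * int j)) * q powi (inv2 n * (int j)\<^sup>2)"
      unfolding D_def using ij carr(1)
      by (simp add: mat_diag_mult_left[of _ n n] mat_diag_mult_right[of _ n n])
         (simp add: F_def fourier_factor_def)
    moreover have "root_exp n (- a) powi (int i * int j) = q powi (- (int i * int j))"
      by (simp add: root_exp_minus q_def power_int_inverse power_int_minus)
    ultimately show "fourier_factor n q R $$ (i, j) = (D * F * D) $$ (i, j)"
      using ij by (simp add: fourier_factor_def)
  qed (use carr in \<open>auto simp: fourier_factor_def\<close>)
  hence "Determinant.det (fourier_factor n q R) = (Determinant.det D * Determinant.det D) * Determinant.det F"
    using carr by (simp add: det_mult[of _ n])
  also have "Determinant.det D * Determinant.det D = (\<Prod>i<n. q powi (2 * inv2 n * (int i)\<^sup>2))"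
    unfolding D_def det_mat_diag prod.distrib[symmetric] using q0
    by (intro prod.cong refl) (simp add: mult.assoc flip: power_int_add)
  also have "\<dots> = (\<Prod>i<n. exp (2 * pi * \<i> * of_int a / of_nat n * of_real ((real i)\<^sup>2)))"
    unfolding half by (simp add: q_def root_exp_powi mult_ac)
  also have "\<dots> = exp (2 * pi * \<i> * of_int a / of_nat n * of_real (\<Sum>i<n. (real i)\<^sup>2))"
    by (simp only: exp_sum[symmetric] finite_lessThan sum_distrib_left of_real_sum)
  also have "2 * pi * \<i> * of_int a / of_nat n * of_real (\<Sum>i<n. (real i)\<^sup>2)
      = 2 * pi * \<i> * of_real (of_int a * (real n - 1) * (2 * real n - 1) / 6)"
    unfolding sum_nat_square using n by (simp add: field_simps)
  finally show ?thesis by (simp add: F_def q_def det_fourier_L_def)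
qed

text \<open>The exponent of \<open>exp (- \<pi>\<i> n s(- 2 a, n))\<close> in the determinant of the Fourier matrix of a letter.\<close>
definition fourier_weight :: "letter \<Rightarrow> nat" where
  "fourier_weight x = (case x of L \<Rightarrow> 3 | R \<Rightarrow> 1)"

text \<open>With \<open>E = \<sigma>' X / Y\<close>, where \<open>\<sigma>'\<close> and \<open>\<sigma>\<close> are the floor signs of \<open>- 2 a\<close> and \<open>a\<close>, the determinants are
  \<open>\<sigma> Y\<close> for \<open>L\<close> and \<open>\<sigma> X / Y\<close> for \<open>R\<close>, while the Jacobi symbol is \<open>\<sigma> \<sigma>'\<close>. The case of \<open>R\<close> is then
  immediate, and the case of \<open>L\<close> holds because \<open>X\<^sup>3 = 1\<close> and \<open>Y\<^sup>4 = 1\<close>.\<close>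
lemma det_fourier_factor:
  assumes "odd n" and cop: "coprime a (int n)"
  shows "Determinant.det (fourier_factor n (root_exp n a) x)
       = of_int (jacobi (- 2) n)
         * exp (- \<i> * pi * of_real (real n * dedekind_sum (- 2 * a) n)) ^ fourier_weight x"
proof -
  have n: "n > 0" using \<open>odd n\<close> by (rule odd_pos)
  obtain h where h: "n = 2 * h + 1" using \<open>odd n\<close> by (auto elim: oddE)
  define X where "X = exp (2 * pi * \<i> * of_real (of_int a * (real n - 1) * (2 * real n - 1) / 6))"
  define Y where "Y = exp (\<i> * pi * of_real (real n * (real n - 1) / 4))"
  define E where "E = exp (- \<i> * pi * of_real (real n * dedekind_sum (- 2 * a) n))"
  have Y0: "Y \<noteq> 0" by (simp add: Y_def)
  have E: "E = floor_sign n (- 2 * a) * X / Y"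
  proof -
    have "exp (- \<i> * pi * of_real (real n * (real n - 1) / 4)) = inverse Y"
      unfolding Y_def exp_minus[symmetric] by (simp only: mult_minus_left)
    thus ?thesis
      unfolding E_def exp_dedekind_sum[OF assms] X_def[symmetric] by (simp only: divide_inverse)
  qed
  have J: "of_int (jacobi (- 2) n) = floor_sign n (- 2 * a) * floor_sign n a"
    by (rule of_int_jacobi_minus_two[OF assms])
  have LY: "det_fourier_L n a = floor_sign n a * Y"
    unfolding Y_def by (rule det_fourier_L_eq[OF assms])
  have X3: "X ^ 3 = 1"
  proof -
    have "X ^ 3 = exp (of_nat 3 * (2 * pi * \<i> * of_real (of_int a * (real n - 1) * (2 * real n - 1) / 6)))"
      unfolding X_def by (rule exp_of_nat_mult[symmetric])
    also have "of_nat 3 * (2 * pi * \<i> * of_real (of_int a * (real n - 1) * (2 * real n - 1) / 6)) = \<i> * pi * of_int (2 * (a * int h * (2 * int n - 1)))"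
      by (simp add: h field_simps)
    also have "exp \<dots> = 1" unfolding exp_minus_one_power minus_one_powi by simp
    finally show ?thesis .
  qed
  have Y4: "Y ^ 4 = 1"
  proof -
    have "Y ^ 4 = exp (of_nat 4 * (\<i> * pi * of_real (real n * (real n - 1) / 4)))"
      unfolding Y_def by (rule exp_of_nat_mult[symmetric])
    also have "of_nat 4 * (\<i> * pi * of_real (real n * (real n - 1) / 4)) = \<i> * pi * of_int (2 * (int n * int h))"
      by (simp add: h field_simps)
    also have "exp \<dots> = 1" unfolding exp_minus_one_power minus_one_powi by simp
    finally show ?thesis .
  qed
  show ?thesis
  proof (cases x)
    case L
    have "E ^ 3 = floor_sign n (- 2 * a) * Y"
    proof -
      have "E ^ 3 = (floor_sign n (- 2 * a) * floor_sign n (- 2 * a)) * floor_sign n (- 2 * a) * X ^ 3 / Y ^ 3"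
        unfolding E by (simp add: power3_eq_cube)
      also have "\<dots> = floor_sign n (- 2 * a) * (1 / Y ^ 3)" using X3 by simp
      also have "1 / Y ^ 3 = Y"
      proof -
        have "Y * Y ^ 3 = 1" using Y4 by (simp add: power4_eq_xxxx power3_eq_cube mult_ac)
        thus ?thesis using Y0 by (simp add: field_simps)
      qed
      finally show ?thesis .
    qed
    hence "of_int (jacobi (- 2) n) * E ^ 3
      = (floor_sign n (- 2 * a) * floor_sign n (- 2 * a)) * (floor_sign n a * Y)"
      by (simp only: J mult_ac)
    thus ?thesis using L LY by (simp add: fourier_weight_def E_def det_fourier_L_def)
  next
    case R
    have "det_fourier_L n (- a) = floor_sign n a / Y"
    proof -
      have "floor_sign n a * Y * det_fourier_L n (- a) = 1"
        using det_fourier_L_mult_minus[OF n cop] LY by simp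
      hence "floor_sign n a * (floor_sign n a * Y * det_fourier_L n (- a)) = floor_sign n a"
        by simp
      hence "(floor_sign n a * floor_sign n a) * (Y * det_fourier_L n (- a)) = floor_sign n a"
        by (simp only: mult.assoc)
      thus ?thesis using Y0 by (simp add: field_simps)
    qed
    hence "Determinant.det (fourier_factor n (root_exp n a) R) = X * floor_sign n a / Y"
      using det_fourier_R[OF assms] by (simp add: X_def)
    also have "\<dots> = (floor_sign n (- 2 * a) * floor_sign n (- 2 * a)) * (X * floor_sign n a / Y)"
      by simp
    also have "\<dots> = of_int (jacobi (- 2) n) * E" unfolding J E by (simp only: mult_ac times_divide_eq_right times_divide_eq_left)
    finally show ?thesis using R by (simp add: fourier_weight_def E_def)
  qed
qed

section \<open>Neumann--Zagier data of a word\<close>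

definition cyc_pred :: "nat \<Rightarrow> nat \<Rightarrow> nat" where
  "cyc_pred n j = (j + n - 1) mod n"

lemma cyc_pred_mod: "n > 0 \<Longrightarrow> cyc_pred n (j mod n) = cyc_pred n j"
  using mod_add_left_eq[of j n "n - 1"] by (simp add: cyc_pred_def)

lemma cyc_pred_add: "1 \<le> r \<Longrightarrow> cyc_pred n (i + r) = (i + (r - 1)) mod n"
  using mod_add_self2[of "i + (r - 1)" n] by (simp add: cyc_pred_def add.assoc)

lemma cyc_pred_Suc: "i < n \<Longrightarrow> cyc_pred n (Suc i) = i"
  using cyc_pred_add[of 1 n i] by simp

lemma cyc_pred_less: "n > 0 \<Longrightarrow> cyc_pred n j < n"
  by (simp add: cyc_pred_def)

text \<open>Let the edge \<open>j\<close> of the cyclic word join position \<open>j - 1\<close> to position \<open>j\<close> and carry the quadratic form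
  \<open>x\<^sub>j\<^sub>-\<^sub>1 x\<^sub>j\<close> (for \<open>L\<close>) or \<open>(x\<^sub>j - x\<^sub>j\<^sub>-\<^sub>1)\<^sup>2 / 2\<close> (for \<open>R\<close>). Its partial derivatives with respect to \<open>x\<^sub>j\<close> and
  \<open>x\<^sub>j\<^sub>-\<^sub>1\<close> are the following head and tail parts; their sum at a fixed edge is \<open>0\<close> for \<open>R\<close> and
  \<open>x\<^sub>j\<^sub>-\<^sub>1 + x\<^sub>j\<close> for \<open>L\<close>.\<close>
definition head_part :: "letter list \<Rightarrow> (nat \<Rightarrow> 'a::comm_ring_1) \<Rightarrow> nat \<Rightarrow> 'a" where
  "head_part w x j = (let N = length w in case w ! (j mod N) of
     L \<Rightarrow> x (cyc_pred N j) | R \<Rightarrow> x (j mod N) - x (cyc_pred N j))"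

definition tail_part :: "letter list \<Rightarrow> (nat \<Rightarrow> 'a::comm_ring_1) \<Rightarrow> nat \<Rightarrow> 'a" where
  "tail_part w x j = (let N = length w in case w ! (j mod N) of
     L \<Rightarrow> x (j mod N) | R \<Rightarrow> x (cyc_pred N j) - x (j mod N))"

text \<open>The gradient of the sum of all edge forms. It turns out to be the matrix \<open>Q\<close> applied to \<open>x\<close>.
  The coefficient ring is arbitrary because \<open>x\<close> will be both an integer vector of summation indices
  and a complex vector of logarithms.\<close>
definition layer_form :: "letter list \<Rightarrow> (nat \<Rightarrow> 'a::comm_ring_1) \<Rightarrow> nat \<Rightarrow> 'a" where
  "layer_form w x i = head_part w x i + tail_part w x (i + 1)"

definition is_L :: "letter list \<Rightarrow> nat \<Rightarrow> int" where
  "is_L w j = of_bool (w ! (j mod length w) = L)"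

lemma sum_at_col:
  assumes "w \<noteq> []"
  shows "(\<Sum>j<length w. of_int (at_col w i j) * x j) = (x (i mod length w) :: 'a::comm_ring_1)"
proof -
  have "(\<Sum>j<length w. of_int (at_col w i j) * x j)
      = (\<Sum>j<length w. if i mod length w = j then x j else 0)"
    by (intro sum.cong) (auto simp: at_col_def)
  thus ?thesis using assms by simp
qed

lemma sum_sum_at_col:
  assumes "w \<noteq> []"
  shows "(\<Sum>j<length w. of_int (\<Sum>r<g. at_col w (i + r) j) * x j)
       = (\<Sum>r<g. x ((i + r) mod length w) :: 'a::comm_ring_1)"
  unfolding of_int_sum sum_distrib_right
  by (subst sum.swap) (simp add: sum_at_col[OF assms])

lemma nzB_row:
  fixes y :: "nat \<Rightarrow> 'a::comm_ring_1"
  assumes "w \<noteq> []" "i < length w"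
  shows "(\<Sum>j<length w. of_int (nzB w $$ (i, j)) * y j) =
    (if i = length w - 1 then 2 * y i
     else (case w ! i of L \<Rightarrow> 2 | R \<Rightarrow> - 2) * (\<Sum>r<gap w i. y ((i + r) mod length w)))"
proof (cases "i = length w - 1")
  case True
  have "(\<Sum>j<length w. of_int (nzB w $$ (i, j)) * y j) = (\<Sum>j<length w. 2 * (of_int (at_col w i j) * y j))"
    using True assms by (intro sum.cong) (auto simp: nzB_def Let_def)
  thus ?thesis
    using True assms by (simp add: sum_at_col flip: sum_distrib_left)
next
  case False
  have "(\<Sum>j<length w. of_int (nzB w $$ (i, j)) * y j)
      = (\<Sum>j<length w. (case w ! i of L \<Rightarrow> 2 | R \<Rightarrow> - 2) * (of_int (\<Sum>r<gap w i. at_col w (i + r) j) * y j))"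
    using False assms by (intro sum.cong) (auto simp: nzB_def Let_def split: letter.splits)
  thus ?thesis
    using False by (simp only: sum_distrib_left[symmetric] sum_sum_at_col[OF assms(1)]) simp
qed

lemma nzA_row:
  fixes x :: "nat \<Rightarrow> 'a::comm_ring_1"
  assumes "w \<noteq> []" "i < length w"
  shows "(\<Sum>j<length w. of_int (nzA w $$ (i, j)) * x j) = (let N = length w in
    if i = N - 1 then - x (cyc_pred N i) + x i + x ((i + 1) mod N)
    else x (cyc_pred N i) + x ((i + gap w i) mod N)
         + (case w ! i of L \<Rightarrow> 0 | R \<Rightarrow> - 2 * (\<Sum>r<gap w i. x ((i + r) mod N))))"
proof -
  define N where "N = length w"
  let ?c = "\<lambda>i j. of_int (at_col w i j) * x j"
  have *: "(\<Sum>j<length w. ?c l j) = x (l mod N)" for l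
    unfolding N_def by (rule sum_at_col[OF assms(1)])
  show ?thesis
  proof (cases "i = N - 1")
    case True
    have "(\<Sum>j<length w. of_int (nzA w $$ (i, j)) * x j)
        = (\<Sum>j<length w. - ?c (i + N - 1) j + ?c i j + ?c (i + 1) j)"
      using True assms by (intro sum.cong) (auto simp: nzA_def Let_def N_def algebra_simps)
    also have "\<dots> = - x (cyc_pred N i) + x (i mod N) + x ((i + 1) mod N)"
      by (simp only: sum.distrib sum_negf * cyc_pred_def)
    finally show ?thesis
      using True assms(2) by (simp only: N_def Let_def cyc_pred_def if_True refl mod_less)
  next
    case False
    have "(\<Sum>j<length w. of_int (nzA w $$ (i, j)) * x j)
        = (\<Sum>j<length w. ?c (i + N - 1) j + ?c (i + gap w i) j
             + (case w ! i of L \<Rightarrow> 0 | R \<Rightarrow> - 2) * (of_int (\<Sum>r<gap w i. at_col w (i + r) j) * x j))"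
      using False assms
      by (intro sum.cong) (auto simp: nzA_def Let_def N_def algebra_simps split: letter.splits)
    also have "\<dots> = x (cyc_pred N i) + x ((i + gap w i) mod N)
           + (case w ! i of L \<Rightarrow> 0 | R \<Rightarrow> - 2) * (\<Sum>r<gap w i. x ((i + r) mod N))"
      by (simp only: sum.distrib * sum_distrib_left[symmetric] sum_sum_at_col[OF assms(1)] cyc_pred_def N_def)
    finally show ?thesis using False by (simp add: N_def Let_def cyc_pred_def split: letter.splits)
  qed
qed

lemma gap_letter:
  assumes "i < length w"
  shows "w ! ((i + gap w i) mod length w) = w ! i"
proof -
  have "1 \<le> length w \<and> w ! ((i + length w) mod length w) = w ! i" using assms by auto
  from LeastI[of "\<lambda>k. 1 \<le> k \<and> w ! ((i + k) mod length w) = w ! i", OF this]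
  show ?thesis unfolding gap_def by simp
qed

lemma before_gap_letter:
  assumes "1 \<le> r" "r < gap w i"
  shows "w ! ((i + r) mod length w) \<noteq> w ! i"
  using gap_le[of r w i] assms by auto

text \<open>Over a block of positions, each interior edge contributes its head and its tail, whereas the first
  edge contributes only its head and the last one only its tail.\<close>
lemma sum_head_tail:
  fixes f g :: "nat \<Rightarrow> 'a::comm_ring_1"
  assumes "1 \<le> k"
  shows "(\<Sum>r<k. f (i + r) + g (i + r + 1)) = f i + (\<Sum>r\<in>{1..<k}. f (i + r) + g (i + r)) + g (i + k)"
  using assms
  by (induction k rule: dec_induct) (simp_all add: algebra_simps)

lemma layer_form_mod: "layer_form w x (i mod length w) = layer_form w x i"
proof (cases "w = []")
  case False
  hence "head_part w x (j mod length w) = head_part w x j"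
    and "tail_part w x (j mod length w) = tail_part w x j" for j
    by (simp_all add: head_part_def tail_part_def Let_def cyc_pred_mod split: letter.split)
  thus ?thesis
    unfolding layer_form_def by (metis Suc_eq_plus1 mod_Suc_eq)
qed simp

lemma is_L_mod: "is_L w (i mod length w) = is_L w i" "is_L w (Suc (i mod length w)) = is_L w (Suc i)"
  by (simp_all add: is_L_def mod_Suc_eq)

text \<open>The polar form of the quadratic form of one edge. The primed arguments belong to the start of
  the edge.\<close>
definition edge_pairing :: "letter \<Rightarrow> 'a::comm_ring_1 \<Rightarrow> 'a \<Rightarrow> 'a \<Rightarrow> 'a \<Rightarrow> 'a" where
  "edge_pairing c x' x y' y = (case c of L \<Rightarrow> y * x' + y' * x | R \<Rightarrow> (y - y') * (x - x'))"

locale nz_word =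
  fixes w :: "letter list"
  assumes ne: "w \<noteq> []" and hd_L: "hd w = L" and last_R: "last w = R"
begin

abbreviation "N \<equiv> length w"

lemma N_pos: "N > 0" using ne by simp

lemma first_letter: "w ! 0 = L" and last_letter: "w ! (N - 1) = R"
  using ne hd_L last_R by (simp_all add: hd_conv_nth last_conv_nth)

text \<open>In the row of a letter \<open>L\<close> the interior edges of the block carry \<open>R\<close> and cancel. In the row of a
  letter \<open>R\<close> they carry \<open>L\<close>, and their contributions \<open>x\<^sub>j\<^sub>-\<^sub>1 + x\<^sub>j\<close> combine with the two ends to twice the
  sum over the block; this is the source of the entries \<open>-2\<close> of \<open>A\<close>.\<close>
lemma nzB_layer_form:
  fixes x :: "nat \<Rightarrow> 'a::comm_ring_1"
  assumes i: "i < N"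
  shows "(\<Sum>j<N. of_int (nzB w $$ (i, j)) * layer_form w x j)
       = 2 * (\<Sum>j<N. of_int (nzA w $$ (i, j)) * x j)"
proof (cases "i = N - 1")
  case True
  have "Suc i = N" using True N_pos by simp
  moreover have "cyc_pred N N = i"
    using True N_pos cyc_pred_mod[OF N_pos, of N] by (simp add: cyc_pred_def)
  moreover have "w ! i = R" using True last_letter by simp
  ultimately have "layer_form w x i = - x (cyc_pred N i) + x i + x ((i + 1) mod N)"
    using i first_letter by (simp add: layer_form_def head_part_def tail_part_def Let_def)
  thus ?thesis
    unfolding nzB_row[OF ne i] nzA_row[OF ne i] by (simp only: if_P[OF True] Let_def)
next
  case False
  define g where "g = gap w i"
  define X where "X r = x ((i + r) mod N)" for r
  have g1: "1 \<le> g" using gap_pos[OF i] by (simp add: g_def)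
  have prev: "cyc_pred N (i + r) = (i + (r - 1)) mod N" if "1 \<le> r" for r
    using that by (rule cyc_pred_add)
  have *: "(\<Sum>r<g. layer_form w x ((i + r) mod N))
      = head_part w x i + (\<Sum>r\<in>{1..<g}. head_part w x (i + r) + tail_part w x (i + r)) + tail_part w x (i + g)"
    unfolding layer_form_mod using sum_head_tail[OF g1, of "head_part w x" i "tail_part w x"]
    by (simp add: layer_form_def)
  have end_letter: "w ! ((i + g) mod N) = w ! i" unfolding g_def by (rule gap_letter[OF i])
  have mid_letter: "w ! ((i + r) mod N) \<noteq> w ! i" if "r \<in> {1..<g}" for r
    using before_gap_letter[of r w i] that by (simp add: g_def)
  show ?thesis
  proof (cases "w ! i")
    case L
    have "(\<Sum>r\<in>{1..<g}. head_part w x (i + r) + tail_part w x (i + r)) = 0"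
    proof (rule sum.neutral, rule ballI)
      fix r assume "r \<in> {1..<g}"
      with mid_letter L have "w ! ((i + r) mod N) = R" by (cases "w ! ((i + r) mod N)") auto
      thus "head_part w x (i + r) + tail_part w x (i + r) = 0"
        by (simp add: head_part_def tail_part_def Let_def)
    qed
    hence "(\<Sum>r<g. layer_form w x ((i + r) mod N)) = x (cyc_pred N i) + x ((i + g) mod N)"
      unfolding * using L end_letter i by (simp add: head_part_def tail_part_def Let_def)
    thus ?thesis
      unfolding nzB_row[OF ne i] nzA_row[OF ne i] using False L by (simp add: g_def Let_def)
  next
    case R
    have mid: "(\<Sum>r\<in>{1..<g}. head_part w x (i + r) + tail_part w x (i + r)) = (\<Sum>r\<in>{1..<g}. X (r - 1) + X r)"
    proof (rule sum.cong[OF refl])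
      fix r assume r: "r \<in> {1..<g}"
      with mid_letter R have "w ! ((i + r) mod N) = L" by (cases "w ! ((i + r) mod N)") auto
      thus "head_part w x (i + r) + tail_part w x (i + r) = X (r - 1) + X r"
        using prev[of r] r by (simp add: head_part_def tail_part_def Let_def X_def)
    qed
    have tot: "X 0 + (\<Sum>r\<in>{1..<g}. X (r - 1) + X r) + X (g - 1) = 2 * (\<Sum>r<g. X r)"
      using g1 by (induction g rule: dec_induct) (simp_all add: algebra_simps)
    have hd_x: "head_part w x i = X 0 - x (cyc_pred N i)"
      using R i by (simp add: head_part_def Let_def X_def)
    have tl_x: "tail_part w x (i + g) = X (g - 1) - X g"
      using R end_letter prev[OF g1] by (simp add: tail_part_def Let_def X_def)
    have "(\<Sum>r<g. layer_form w x ((i + r) mod N))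
        = 2 * (\<Sum>r<g. X r) - x (cyc_pred N i) - X g"
      unfolding * mid hd_x tl_x tot[symmetric] by (simp add: algebra_simps)
    thus ?thesis
      unfolding nzB_row[OF ne i] nzA_row[OF ne i] g_def[symmetric] X_def[symmetric] using False R
      by (simp only:) (simp add: Let_def X_def algebra_simps)
  qed
qed

text \<open>The sums over a block telescope as for \<open>layer_form\<close>. The contribution of an edge is now the
  indicator of the letter \<open>L\<close>, with equal signs at head and tail in the first identity, which will
  identify \<open>\<eta>\<close>, and opposite ones in the second, which will identify the last column of \<open>2 B\<^sup>-\<^sup>1\<close>.\<close>
lemma nzB_is_L:
  assumes i: "i < N"
  shows "(\<Sum>j<N. nzB w $$ (i, j) * (is_L w j + is_L w (j + 1))) = 2 * nznu w $ i"
    and "(\<Sum>j<N. nzB w $$ (i, j) * (is_L w (j + 1) - is_L w j)) = (if i = N - 1 then 2 else 0)"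
proof -
  have end_letter: "is_L w (i + gap w i) = is_L w i"
    using gap_letter[OF i] i by (simp add: is_L_def)
  have mid_letter: "is_L w (i + r) = 1 - is_L w i" if "r \<in> {1..<gap w i}" for r
    using before_gap_letter[of r w i] that i
    by (cases "w ! i"; cases "w ! ((i + r) mod N)") (auto simp: is_L_def)
  have val: "w ! i = L \<Longrightarrow> is_L w i = 1" "w ! i = R \<Longrightarrow> is_L w i = 0"
    using i by (simp_all add: is_L_def)
  have last: "w ! i = R" "is_L w (Suc i) = 1" if "i = N - 1"
    using that N_pos last_letter first_letter by (simp_all add: is_L_def)
  note row = nzB_row[OF ne i, where 'a = int, simplified]
  have "(\<Sum>r<gap w i. is_L w (i + r) + is_L w (i + r + 1)) =
      is_L w i + (\<Sum>r\<in>{1..<gap w i}. is_L w (i + r) + is_L w (i + r)) + is_L w (i + gap w i)"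
    by (rule sum_head_tail[OF gap_pos[OF i]])
  also have "\<dots> = 2 * is_L w i + 2 * (int (gap w i) - 1) * (1 - is_L w i)"
    using gap_pos[OF i] by (simp add: mid_letter end_letter of_nat_diff) (simp add: algebra_simps)
  finally have plus: "(\<Sum>r<gap w i. is_L w (i + r) + is_L w (i + r + 1))
     = 2 * is_L w i + 2 * (int (gap w i) - 1) * (1 - is_L w i)" .
  have "(\<Sum>r<gap w i. - is_L w (i + r) + is_L w (i + r + 1)) =
      - is_L w i + (\<Sum>r\<in>{1..<gap w i}. - is_L w (i + r) + is_L w (i + r)) + is_L w (i + gap w i)"
    by (rule sum_head_tail[OF gap_pos[OF i], of "\<lambda>j. - is_L w j"])
  hence minus: "(\<Sum>r<gap w i. is_L w (i + r + 1) - is_L w (i + r)) = 0"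
    by (simp add: end_letter)
  show "(\<Sum>j<N. nzB w $$ (i, j) * (is_L w j + is_L w (j + 1))) = 2 * nznu w $ i"
    unfolding row using i plus val last
    by (cases "w ! i"; cases "i = N - 1") (simp_all add: is_L_mod nznu_def Let_def)
  show "(\<Sum>j<N. nzB w $$ (i, j) * (is_L w (j + 1) - is_L w j)) = (if i = N - 1 then 2 else 0)"
    unfolding row using minus val last
    by (cases "w ! i"; cases "i = N - 1") (simp_all add: is_L_mod)
qed

lemma twoBinv: "twoBinv w \<in> carrier_mat N N" "twoBinv w * nzB w = 2 \<cdot>\<^sub>m 1\<^sub>m N"
  using theI'[OF ex1_twoBinv[OF ne hd_L last_R]] unfolding twoBinv_def by auto

text \<open>This evaluates \<open>2 B\<^sup>-\<^sup>1\<close> on a vector once a solution of the linear system is guessed. It serves over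
  the integers for the matrix data and over the complex numbers for the gluing equations.\<close>
lemma twoBinv_unique_solution:
  fixes y t :: "nat \<Rightarrow> 'a::{idom, ring_char_0}"
  assumes eq: "\<And>i. i < N \<Longrightarrow> (\<Sum>j<N. of_int (nzB w $$ (i, j)) * y j) = 2 * t i" and l: "l < N"
  shows "(\<Sum>i<N. of_int (twoBinv w $$ (l, i)) * t i) = y l"
proof -
  have inv: "(\<Sum>i<N. twoBinv w $$ (l, i) * nzB w $$ (i, j)) = (if l = j then 2 else 0)" if "j < N" for j
  proof -
    have "(twoBinv w * nzB w) $$ (l, j) = (\<Sum>i<N. twoBinv w $$ (l, i) * nzB w $$ (i, j))"
      using twoBinv(1) l that by (simp add: scalar_prod_def nzB_def Let_def lessThan_atLeast0)
    thus ?thesis using twoBinv(2) l that by (cases "l = j") auto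
  qed
  have "2 * (\<Sum>i<N. of_int (twoBinv w $$ (l, i)) * t i)
      = (\<Sum>i<N. of_int (twoBinv w $$ (l, i)) * (2 * t i))"
    by (simp add: sum_distrib_left mult_ac)
  also have "\<dots> = (\<Sum>i<N. of_int (twoBinv w $$ (l, i)) * (\<Sum>j<N. of_int (nzB w $$ (i, j)) * y j))"
    by (intro sum.cong refl) (simp add: eq)
  also have "\<dots> = (\<Sum>j<N. of_int (\<Sum>i<N. twoBinv w $$ (l, i) * nzB w $$ (i, j)) * y j)"
    unfolding sum_distrib_left sum_distrib_right of_int_sum
    by (subst sum.swap) (simp add: mult_ac)
  also have "\<dots> = (\<Sum>j<N. if l = j then 2 * y j else 0)"
    by (intro sum.cong refl) (simp add: inv)
  also have "\<dots> = 2 * y l" using l by simp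
  finally show ?thesis by simp
qed

lemma twoBinv_mult_vec:
  assumes "v \<in> carrier_vec N" "l < N"
  shows "(twoBinv w *\<^sub>v v) $ l = (\<Sum>i<N. twoBinv w $$ (l, i) * v $ i)"
  using assms twoBinv(1) by (simp add: scalar_prod_def lessThan_atLeast0)

lemma nzeta_eq: "l < N \<Longrightarrow> nzeta w $ l = is_L w l + is_L w (l + 1)"
  unfolding nzeta_def
  using twoBinv_unique_solution[of "\<lambda>j. is_L w j + is_L w (j + 1)" "\<lambda>i. nznu w $ i" l] nzB_is_L(1)
  by (simp add: twoBinv_mult_vec nznu_def Let_def)

lemma beta_eq: "i < N \<Longrightarrow> beta w i = is_L w (i + 1) - is_L w i"
  by (auto simp: beta_def is_L_def split: letter.splits)

lemma twoBinv_last: "l < N \<Longrightarrow> twoBinv w $$ (l, N - 1) = beta w l"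
proof -
  assume l: "l < N"
  have "(\<Sum>i<N. twoBinv w $$ (l, i) * (if i = N - 1 then 1 else 0)) = is_L w (l + 1) - is_L w l"
    using twoBinv_unique_solution[of "\<lambda>j. is_L w (j + 1) - is_L w j" "\<lambda>i. if i = N - 1 then 1 else 0" l]
      nzB_is_L(2) l by (simp cong: if_cong)
  moreover have "N - 1 < N" using N_pos by simp
  ultimately show ?thesis using l by (simp add: beta_eq if_distrib[of "\<lambda>x. _ * x"] cong: if_cong)
qed

lemma twoBinv_nu_shift:
  assumes l: "l < N"
  shows "(twoBinv w *\<^sub>v (nznu w - (2 * m) \<cdot>\<^sub>v unit_vec N (N - 1))) $ l = nzeta w $ l - 2 * m * beta w l"
proof -
  have nu: "nznu w \<in> carrier_vec N" by (simp add: nznu_def Let_def)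
  have "(twoBinv w *\<^sub>v (nznu w - (2 * m) \<cdot>\<^sub>v unit_vec N (N - 1))) $ l
      = (\<Sum>i<N. twoBinv w $$ (l, i) * nznu w $ i - (if i = N - 1 then twoBinv w $$ (l, i) * (2 * m) else 0))"
    using nu l by (subst twoBinv_mult_vec) (auto intro!: sum.cong simp: algebra_simps)
  also have "\<dots> = nzeta w $ l - twoBinv w $$ (l, N - 1) * (2 * m)"
    using l nu by (simp add: sum_subtractf nzeta_def twoBinv_mult_vec)
  finally show ?thesis unfolding twoBinv_last[OF l] by simp
qed

lemma nzQ_mult_vec:
  assumes l: "l < N"
  shows "(nzQ w *\<^sub>v vec N k) $ l = layer_form w k l"
proof -
  have A: "nzA w \<in> carrier_mat N N" by (simp add: nzA_def Let_def)
  have "(nzQ w *\<^sub>v vec N k) $ l = (twoBinv w *\<^sub>v (nzA w *\<^sub>v vec N k)) $ l"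
    unfolding nzQ_def using assoc_mult_mat_vec[OF twoBinv(1) A, of "vec N k"] by simp
  also have "\<dots> = (\<Sum>i<N. twoBinv w $$ (l, i) * (\<Sum>j<N. nzA w $$ (i, j) * k j))"
    using A l by (subst twoBinv_mult_vec) (auto simp: scalar_prod_def lessThan_atLeast0 intro!: sum.cong)
  also have "\<dots> = layer_form w k l"
    using twoBinv_unique_solution[of "layer_form w k" "\<lambda>i. \<Sum>j<N. nzA w $$ (i, j) * k j" l]
      nzB_layer_form[of _ k] l by simp
  finally show ?thesis .
qed

text \<open>The gluing equations solved for the logarithms: both sides solve the same linear system with
  matrix \<open>B\<close>.\<close>
lemma layer_form_log_shapes:
  assumes cs: "complete_structure w z" and l: "l < N"
  shows "layer_form w (\<lambda>j. ln (shape' z j)) l + 2 * ln (z l) = pi * \<i> * of_int (nzeta w $ l)"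
proof -
  define t where "t i = pi * \<i> * of_int (nznu w $ i)" for i
  have "(\<Sum>i<N. of_int (twoBinv w $$ (l, i)) * t i) = layer_form w (\<lambda>j. ln (shape' z j)) l + 2 * ln (z l)"
  proof (rule twoBinv_unique_solution[OF _ l])
    fix i assume i: "i < N"
    have "(\<Sum>j<N. of_int (nzB w $$ (i, j)) * (layer_form w (\<lambda>j. ln (shape' z j)) j + 2 * ln (z j)))
       = 2 * (\<Sum>j<N. of_int (nzA w $$ (i, j)) * ln (shape' z j)) + 2 * (\<Sum>j<N. of_int (nzB w $$ (i, j)) * ln (z j))"
      using nzB_layer_form[OF i, of "\<lambda>j. ln (shape' z j)"]
      by (simp add: algebra_simps sum.distrib sum_distrib_left)
    also have "\<dots> = 2 * t i"
      using cs i unfolding complete_structure_def t_def by (simp add: sum.distrib flip: distrib_left)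
    finally show "(\<Sum>j<N. of_int (nzB w $$ (i, j)) * (layer_form w (\<lambda>j. ln (shape' z j)) j + 2 * ln (z j))) = 2 * t i" .
  qed
  moreover have "(\<Sum>i<N. of_int (twoBinv w $$ (l, i)) * t i) = pi * \<i> * of_int (nzeta w $ l)"
  proof (rule twoBinv_unique_solution[OF _ l])
    fix i assume i: "i < N"
    have "of_int (2 * nznu w $ i) = (\<Sum>j<N. of_int (nzB w $$ (i, j)) * (of_int (nzeta w $ j)) :: complex)"
      unfolding nzB_is_L(1)[OF i, symmetric] of_int_sum by (intro sum.cong refl) (simp add: nzeta_eq)
    thus "(\<Sum>j<N. of_int (nzB w $$ (i, j)) * (pi * \<i> * of_int (nzeta w $ j))) = 2 * t i"
      by (simp add: t_def mult_ac flip: sum_distrib_left)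
  qed
  ultimately show ?thesis by simp
qed

lemma sum_mult_layer_form:
  fixes x y :: "nat \<Rightarrow> 'a::comm_ring_1"
  shows "(\<Sum>i<N. y i * layer_form w x i)
     = (\<Sum>i<N. edge_pairing (w ! i) (x (cyc_pred N i)) (x i) (y (cyc_pred N i)) (y i))"
proof -
  define f where "f j = y (cyc_pred N j) * tail_part w x j" for j
  have "(\<Sum>i<N. y i * tail_part w x (i + 1)) = (\<Sum>i<N. f (Suc i))"
    by (intro sum.cong refl) (simp add: f_def cyc_pred_Suc)
  also have "\<dots> = (\<Sum>i<N. f i)"
  proof -
    have "f N = f 0"
      using cyc_pred_mod[OF N_pos, of N] by (simp add: f_def tail_part_def Let_def split: letter.split)
    thus ?thesis using sum.lessThan_Suc_shift[of f N] sum.lessThan_Suc[of f N] by simp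
  qed
  finally have "(\<Sum>i<N. y i * layer_form w x i) = (\<Sum>i<N. y i * head_part w x i + f i)"
    by (simp add: layer_form_def algebra_simps sum.distrib)
  also have "\<dots> = (\<Sum>i<N. edge_pairing (w ! i) (x (cyc_pred N i)) (x i) (y (cyc_pred N i)) (y i))"
    by (intro sum.cong refl)
       (auto simp: f_def head_part_def tail_part_def edge_pairing_def Let_def algebra_simps split: letter.splits)
  finally show ?thesis .
qed

text \<open>Being a gradient of a quadratic form, \<open>layer_form\<close> has a symmetric matrix, namely \<open>Q\<close>.\<close>
lemma sum_layer_form_symmetric:
  "(\<Sum>i<N. y i * layer_form w x i) = (\<Sum>i<N. x i * layer_form w y i)"
  unfolding sum_mult_layer_form
  by (intro sum.cong refl) (auto simp: edge_pairing_def algebra_simps split: letter.splits)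

end

section \<open>Cyclic q-products\<close>

text \<open>The factorisation of \<open>X\<^sup>n - 1\<close>, evaluated at \<open>1 / x\<close>.\<close>
lemma prod_one_minus_root_exp:
  assumes n: "n > 0" and cop: "coprime a (int n)"
  shows "(\<Prod>j<n. 1 - root_exp n a ^ j * x) = 1 - x ^ n"
proof (cases "x = 0")
  case False
  define q where "q = root_exp n a"
  have q0: "q \<noteq> 0" by (simp add: q_def root_exp_def)
  define P where "P = (\<Prod>j<n. [:- (q ^ j), 1:])"
  have inj: "inj_on (\<lambda>j. q ^ j) {..<n}"
  proof (rule inj_onI)
    fix i j assume ij: "i \<in> {..<n}" "j \<in> {..<n}" "q ^ i = q ^ j"
    hence "q powi (int i - int j) = 1" using q0 by (simp add: power_int_diff)
    hence "int n dvd int i - int j" using root_exp_powi_eq_1_iff[OF n cop] by (simp add: q_def)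
    thus "i = j" using ij dvd_imp_le_int[of "int i - int j" "int n"] by (cases "i = j") auto
  qed
  have deg: "Polynomial.degree P = n"
    by (simp add: P_def degree_prod_eq_sum_degree)
  have "lead_coeff P = 1" unfolding P_def by (subst lead_coeff_prod) simp
  moreover have "Polynomial.degree (Polynomial.monom 1 n - 1 :: complex poly) \<le> n"
    by (intro degree_diff_le) (auto simp: degree_monom_le)
  moreover have "poly.coeff (Polynomial.monom 1 n - 1 :: complex poly) n = 1"
    using n by simp
  moreover have "poly P y = poly (Polynomial.monom 1 n - 1) y" if y: "y \<in> (\<lambda>j. q ^ j) ` {..<n}" for y
  proof -
    obtain j where j: "j < n" "y = q ^ j" using y by auto
    have "poly P y = 0" unfolding P_def poly_prod using j by (intro prod_zero bexI[of _ j]) auto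
    moreover have "y ^ n = 1"
      using root_exp_power_n[OF n, of a] by (simp add: j q_def flip: power_mult) (simp add: mult.commute[of j] power_mult)
    ultimately show ?thesis by (simp add: poly_monom)
  qed
  ultimately have "P = Polynomial.monom 1 n - 1"
    using deg inj by (intro poly_eqI_degree_lead_coeff[of _ n _ "(\<lambda>j. q ^ j) ` {..<n}"]) (auto simp: card_image)
  hence "poly P (1 / x) = poly (Polynomial.monom 1 n - 1) (1 / x)" by (simp only:)
  hence "(\<Prod>j<n. 1 / x - q ^ j) = (1 / x) ^ n - 1"
    by (simp add: P_def poly_prod poly_monom)
  hence "x ^ n * (\<Prod>j<n. 1 / x - q ^ j) = x ^ n * ((1 / x) ^ n - 1)" by simp
  also have "x ^ n * (\<Prod>j<n. 1 / x - q ^ j) = (\<Prod>j<n. x * (1 / x - q ^ j))"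
    by (simp add: prod.distrib)
  also have "\<dots> = (\<Prod>j<n. 1 - q ^ j * x)"
    using False by (intro prod.cong refl) (simp add: field_simps)
  also have "x ^ n * ((1 / x) ^ n - 1) = 1 - x ^ n" using False by (simp add: field_simps)
  finally show ?thesis by (simp add: q_def)
qed (use n in \<open>simp add: power_0_left\<close>)

text \<open>Reversing the order of the factors exchanges \<open>q\<close> with its inverse and positive with negative
  lengths. The diagonal entries of \<open>H\<close> use base \<open>\<zeta>\<^sup>-\<^sup>1\<close>, the summand uses base \<open>\<zeta>\<close>.\<close>
lemma qpoch_inverse_base:
  assumes q: "q \<noteq> 0"
  shows "qpoch x (inverse q) k = inverse (qpoch (q * x) q (- k))"
proof -
  have "(\<Prod>j<p. 1 - inverse q ^ j * x) = (\<Prod>j<p. 1 - q ^ j * (q powi (- int p) * (q * x)))" for p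
  proof (rule prod.reindex_bij_witness[of _ "\<lambda>j. p - 1 - j" "\<lambda>j. p - 1 - j"])
    fix j assume "j \<in> {..<p}"
    hence "int (p - 1 - j) = int p + - 1 + - int j" by auto
    hence "q ^ (p - 1 - j) = q powi (int p + - 1 + - int j)" by (metis power_int_of_nat)
    also have "\<dots> = q powi int p * q powi (- 1) * q powi (- int j)" using q by (simp only: power_int_add disj_not1 simp_thms)
    finally show "1 - q ^ (p - 1 - j) * (q powi (- int p) * (q * x)) = 1 - inverse q ^ j * x"
      using q by (simp add: power_int_minus field_simps)
  qed auto
  moreover have neg: "(\<Prod>j<p. 1 - inverse q ^ j * (inverse q powi (- int p) * x)) = (\<Prod>j<p. 1 - q ^ j * (q * x))" for p
  proof (rule prod.reindex_bij_witness[of _ "\<lambda>j. p - 1 - j" "\<lambda>j. p - 1 - j"])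
    fix j assume "j \<in> {..<p}"
    hence "p = (p - 1 - j) + 1 + j" by auto
    hence "q ^ p = q ^ (p - 1 - j) * q * q ^ j" by (metis power_add power_one_right)
    thus "1 - q ^ (p - 1 - j) * (q * x) = 1 - inverse q ^ j * (inverse q powi (- int p) * x)"
      using q by (simp add: power_int_minus power_inverse field_simps)
  qed auto
  ultimately show ?thesis
    using neg[of "nat (- k)"] by (cases "k = 0"; cases "k > 0") (auto simp: qpoch_def)
qed

lemma qpoch_step:
  assumes q: "q \<noteq> 0" and nz: "\<And>j. 1 - q powi j * x \<noteq> 0"
  shows "qpoch x q (k + 1) = qpoch x q k * (1 - q powi k * x)"
proof (cases "k \<ge> 0")
  case True
  hence "nat (k + 1) = Suc (nat k)" "q powi k = q ^ nat k" by (auto simp: power_int_def)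
  thus ?thesis using True by (simp add: qpoch_def)
next
  case False
  define p where "p = nat (- k - 1)"
  have k: "k = - int (Suc p)" and "nat (- k) = Suc p" using False by (auto simp: p_def)
  have "(\<Prod>j<p. 1 - q ^ Suc j * (q powi k * x)) = (\<Prod>j<p. 1 - q ^ j * (q powi (k + 1) * x))"
    using q by (intro prod.cong refl) (simp add: power_int_add mult_ac)
  hence "qpoch x q k = inverse ((1 - q powi k * x) * (\<Prod>j<p. 1 - q ^ j * (q powi (k + 1) * x)))"
    using False \<open>nat (- k) = Suc p\<close>
    by (simp add: qpoch_def prod.lessThan_Suc_shift del: prod.lessThan_Suc)
  moreover have "qpoch x q (k + 1) = inverse (\<Prod>j<p. 1 - q ^ j * (q powi (k + 1) * x))"
    by (cases "p = 0") (auto simp: qpoch_def k)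
  ultimately show ?thesis using nz[of k] by simp
qed

lemma qpoch_add:
  assumes "q \<noteq> 0" "\<And>j. 1 - q powi j * x \<noteq> 0"
  shows "qpoch x q (k + int r) = qpoch x q k * (\<Prod>j<r. 1 - q ^ j * (q powi k * x))"
proof (induction r)
  case (Suc r)
  have "qpoch x q (k + int (Suc r)) = qpoch x q ((k + int r) + 1)" by (simp add: algebra_simps)
  also have "\<dots> = qpoch x q (k + int r) * (1 - q powi (k + int r) * x)"
    by (rule qpoch_step) (use assms in auto)
  finally show ?case using Suc assms(1) by (simp add: power_int_add mult_ac)
qed simp

lemma periodic_mod:
  fixes f :: "int \<Rightarrow> 'a"
  assumes "\<And>k. f (k + n) = f k"
  shows "f (k mod n) = f k"
proof -
  have shift: "f (l + n * int c) = f l" for l c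
    by (induction c) (simp_all add: algebra_simps, metis add.assoc add.commute assms)
  show ?thesis
  proof (cases "k div n \<ge> 0")
    case True
    thus ?thesis using shift[of "k mod n" "nat (k div n)"] by (simp add: mult.commute)
  next
    case False
    hence "k + n * int (nat (- (k div n))) = k mod n" by (simp add: minus_mult_div_eq_mod[symmetric])
    thus ?thesis using shift[of k "nat (- (k div n))"] by simp
  qed
qed

text \<open>The factor \<open>g j\<close> occurs in \<open>n - 1 - j\<close> of the partial products.\<close>
lemma prod_partial_products:
  fixes g :: "nat \<Rightarrow> 'a::comm_monoid_mult"
  shows "(\<Prod>k<n. \<Prod>j<k. g j) * (\<Prod>j<n. g j ^ j) * (\<Prod>j<n. g j) = (\<Prod>j<n. g j) ^ n"
proof (induction n)
  case (Suc n)
  define A B C where "A = (\<Prod>k<n. \<Prod>j<k. g j)" and "B = (\<Prod>j<n. g j ^ j)" and "C = (\<Prod>j<n. g j)"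
  have "(A * C) * (B * g n ^ n) * (C * g n) = (A * B * C) * C * g n ^ n * g n" by (simp add: mult_ac)
  also have "A * B * C = C ^ n" using Suc by (simp add: A_def B_def C_def)
  finally show ?case by (simp add: A_def B_def C_def power_mult_distrib mult_ac)
qed simp

text \<open>Here \<open>u\<close> is the shape. By the previous lemma the double product of the factors \<open>g j = 1 - \<xi>\<^sup>j x\<close> is
  \<open>u\<^bsup>n-1\<^esup>\<close> divided by \<open>S = \<Prod>\<^sub>j (g j)\<^sup>j\<close>, while the powers of \<open>d\<close> multiply to \<open>u\<^bsup>-(n-1)/2\<^esup>\<close>. The
  \<open>n\<close>-th power of the cyclic dilogarithm is \<open>S\<close> up to the exponential of the Dedekind sum; raising to
  the power \<open>n\<close> clears the denominators in front of the logarithms, so their branches do not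
  matter.\<close>
lemma prod_cyclic_weights:
  fixes d x u :: complex
  assumes "odd n" and cop: "coprime b (int n)" and d: "d ^ n * u = 1" and x: "1 - x ^ n = u"
  shows "(\<Prod>k<n. d ^ k * qpoch x (root_exp n b) (int k))
       = u ^ ((n - 1) div 2) * (cyclic_dilog b n x powi (- int n)
           * exp (- \<i> * pi * of_real (real n * dedekind_sum b n)))"
proof -
  have n: "n > 0" using \<open>odd n\<close> by (rule odd_pos)
  obtain h where h: "n = 2 * h + 1" using \<open>odd n\<close> by (auto elim: oddE)
  define g where "g j = 1 - root_exp n b ^ j * x" for j
  have prod_g: "(\<Prod>j<n. g j) = u" unfolding g_def prod_one_minus_root_exp[OF n cop] by (rule x)
  have z0: "u \<noteq> 0" using d by auto
  have g0: "g j \<noteq> 0" if "j < n" for j using prod_g z0 that by (metis finite_lessThan lessThan_iff prod_zero_iff)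
  define S where "S = (\<Prod>j<n. g j ^ j)"
  have S0: "S \<noteq> 0" using g0 by (simp add: S_def)
  have "(\<Prod>k<n. d ^ k) = d ^ (\<Sum>k<n. k)" by (simp add: power_sum)
  also have "(\<Sum>k<n. k) = n * h"
    using Sum_Ico_nat[of 0 n] by (simp add: h lessThan_atLeast0)
  finally have dz: "(\<Prod>k<n. d ^ k) * u ^ h = 1"
    using d by (simp add: power_mult flip: power_mult_distrib)
  have "u ^ n = (u ^ h * u ^ h) * u"
    by (simp add: h power_add mult_2)
  moreover have "(\<Prod>k<n. \<Prod>j<k. g j) * S * u = u ^ n"
    using prod_partial_products[of g n] by (simp add: S_def prod_g)
  ultimately have gS: "(\<Prod>k<n. \<Prod>j<k. g j) * S = u ^ h * u ^ h"
    using z0 by simp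
  have "(\<Prod>k<n. d ^ k * qpoch x (root_exp n b) (int k)) = (\<Prod>k<n. d ^ k) * (\<Prod>k<n. \<Prod>j<k. g j)"
    by (simp add: qpoch_def g_def prod.distrib)
  also have "\<dots> = (\<Prod>k<n. d ^ k) * (u ^ h * u ^ h) / S"
    unfolding gS[symmetric] using S0 by simp
  also have "\<dots> = ((\<Prod>k<n. d ^ k) * u ^ h) * u ^ h / S" by simp
  also have "\<dots> = u ^ h / S" unfolding dz by simp
  finally have lhs: "(\<Prod>k<n. d ^ k * qpoch x (root_exp n b) (int k)) = u ^ h / S" .
  define T where "T = exp (\<i> * pi * of_real (real n * dedekind_sum b n))"
  have "cyclic_dilog b n x ^ n = inverse T * S"
  proof -
    have "cyclic_dilog b n x ^ n
        = exp (of_nat n * (- \<i> * pi * dedekind_sum b n + (\<Sum>j = 1..<n. of_nat j / of_nat n * ln (g j))))"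
      unfolding exp_of_nat_mult cyclic_dilog_def Let_def root_exp_def g_def ..
    also have "of_nat n * (- \<i> * pi * dedekind_sum b n + (\<Sum>j = 1..<n. of_nat j / of_nat n * ln (g j)))
       = - (\<i> * pi * of_real (real n * dedekind_sum b n)) + (\<Sum>j = 1..<n. of_nat j * ln (g j))"
    proof -
      have "(\<Sum>j = 1..<n. of_nat j / of_nat n * ln (g j)) = (\<Sum>j = 1..<n. of_nat j * ln (g j)) / of_nat n"
        by (simp add: sum_divide_distrib)
      thus ?thesis using n by (simp add: field_simps)
    qed
    also have "exp \<dots> = inverse T * exp (\<Sum>j = 1..<n. of_nat j * ln (g j))"
      by (simp only: exp_add exp_minus T_def)
    also have "exp (\<Sum>j = 1..<n. of_nat j * ln (g j)) = (\<Prod>j = 1..<n. g j ^ j)"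
      unfolding exp_sum[OF finite_atLeastLessThan]
      by (intro prod.cong refl) (simp add: exp_of_nat_mult g0)
    also have "\<dots> = S" unfolding S_def
      by (rule prod.mono_neutral_left) (auto simp: not_less_eq_eq)
    finally show ?thesis .
  qed
  hence "cyclic_dilog b n x powi (- int n) = T / S"
    by (simp add: power_int_minus divide_inverse)
  moreover have "exp (- \<i> * pi * of_real (real n * dedekind_sum b n)) = inverse T"
    unfolding T_def exp_minus[symmetric] by (simp only: mult_minus_left)
  moreover have "T \<noteq> 0" by (simp add: T_def)
  moreover have "(n - 1) div 2 = h" by (simp add: h)
  ultimately show ?thesis unfolding lhs by (simp add: field_simps)
qed


section \<open>Traces and determinants of products of matrices\<close>

lemma foldr_mat_mult_carrier:
  assumes "\<And>M. M \<in> set Ms \<Longrightarrow> M \<in> carrier_mat n n" "A \<in> carrier_mat n n"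
  shows "foldr (*) Ms A \<in> carrier_mat n n"
  using assms by (induction Ms) (auto intro!: mult_carrier_mat[of _ n n _ n])

lemma foldr_mat_mult_snoc:
  assumes "\<And>M. M \<in> set Ms \<Longrightarrow> M \<in> carrier_mat n n" "A \<in> carrier_mat n n"
  shows "foldr (*) Ms A = foldr (*) Ms (1\<^sub>m n) * (A :: 'a::semiring_1 mat)"
  using assms
proof (induction Ms)
  case (Cons M Ms)
  thus ?case
    using foldr_mat_mult_carrier[of Ms n "1\<^sub>m n"] by (simp add: assoc_mult_mat[of _ n n _ n _ n])
qed simp

lemma foldr_map_mat_carrier:
  assumes "\<And>l. l < r \<Longrightarrow> M l \<in> carrier_mat n n"
  shows "foldr (*) (map M [0..<r]) (1\<^sub>m n) \<in> carrier_mat n n"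
proof (rule foldr_mat_mult_carrier)
  show "X \<in> carrier_mat n n" if "X \<in> set (map M [0..<r])" for X
    using that assms by auto
qed simp

lemma foldr_map_mat_Suc:
  fixes M :: "nat \<Rightarrow> 'a::semiring_1 mat"
  assumes "\<And>l. l < Suc r \<Longrightarrow> M l \<in> carrier_mat n n"
  shows "foldr (*) (map M [0..<Suc r]) (1\<^sub>m n) = foldr (*) (map M [0..<r]) (1\<^sub>m n) * M r"
proof -
  have "foldr (*) (map M [0..<r]) (M r) = foldr (*) (map M [0..<r]) (1\<^sub>m n) * M r"
    by (rule foldr_mat_mult_snoc) (use assms in auto)
  thus ?thesis using right_mult_one_mat[of "M r" n n] assms[of r] by simp
qed

lemma sum_PiE_lessThan_Suc:
  "(\<Sum>\<kappa>\<in>{..<Suc r} \<rightarrow>\<^sub>E S. f \<kappa>) = (\<Sum>t\<in>S. \<Sum>\<kappa>\<in>{..<r} \<rightarrow>\<^sub>E S. f (\<kappa>(r := t)))"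
proof -
  have "(\<Sum>\<kappa>\<in>{..<Suc r} \<rightarrow>\<^sub>E S. f \<kappa>) = (\<Sum>\<kappa>\<in>(\<lambda>(y, g). g(r := y)) ` (S \<times> ({..<r} \<rightarrow>\<^sub>E S)). f \<kappa>)"
    by (simp add: lessThan_Suc PiE_insert_eq)
  also have "\<dots> = (\<Sum>(t, \<kappa>)\<in>S \<times> ({..<r} \<rightarrow>\<^sub>E S). f (\<kappa>(r := t)))"
    using inj_combinator[of r "{..<r}" "\<lambda>_. S"]
    by (subst sum.reindex) (simp_all add: case_prod_unfold)
  finally show ?thesis by (simp add: sum.cartesian_product)
qed

text \<open>An entry of a product of matrices is a sum over paths from \<open>i\<close> to \<open>j\<close>. The path \<open>\<kappa>\<close> lists the
  indices after each factor, and its end is tested by a factor 0 or 1; so the formula also covers the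
  empty product.\<close>
lemma foldr_mat_mult_entry:
  fixes M :: "nat \<Rightarrow> 'a::comm_semiring_1 mat"
  assumes M: "\<And>l. l < r \<Longrightarrow> M l \<in> carrier_mat n n" and ij: "i < n" "j < n"
  defines "start \<equiv> \<lambda>\<kappa> l. if l = 0 then i else \<kappa> (l - 1)"
  shows "foldr (*) (map M [0..<r]) (1\<^sub>m n) $$ (i, j)
       = (\<Sum>\<kappa>\<in>{..<r} \<rightarrow>\<^sub>E {..<n}. of_bool (start \<kappa> r = j) * (\<Prod>l<r. M l $$ (start \<kappa> l, \<kappa> l)))"
  using M ij(2)
proof (induction r arbitrary: j)
  case 0
  thus ?case using ij(1) by (simp add: start_def)
next
  case (Suc r)
  define P where "P = foldr (*) (map M [0..<r]) (1\<^sub>m n)"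
  define W where "W \<kappa> = (\<Prod>l<r. M l $$ (start \<kappa> l, \<kappa> l))" for \<kappa>
  have P: "P \<in> carrier_mat n n"
    unfolding P_def using Suc.prems(1) by (intro foldr_map_mat_carrier) simp
  have Mr: "M r \<in> carrier_mat n n" using Suc.prems(1) by simp
  have "foldr (*) (map M [0..<Suc r]) (1\<^sub>m n) = P * M r"
    unfolding P_def using Suc.prems(1) by (rule foldr_map_mat_Suc)
  hence "foldr (*) (map M [0..<Suc r]) (1\<^sub>m n) $$ (i, j) = (\<Sum>t<n. P $$ (i, t) * M r $$ (t, j))"
    using P Mr ij(1) Suc.prems(2) by (simp add: scalar_prod_def lessThan_atLeast0)
  also have "\<dots> = (\<Sum>t<n. (\<Sum>\<kappa>\<in>{..<r} \<rightarrow>\<^sub>E {..<n}. of_bool (start \<kappa> r = t) * W \<kappa>) * M r $$ (t, j))"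
    using Suc.IH Suc.prems(1) by (intro sum.cong refl) (simp add: P_def W_def)
  also have "\<dots> = (\<Sum>\<kappa>\<in>{..<r} \<rightarrow>\<^sub>E {..<n}. \<Sum>t<n. if t = start \<kappa> r then W \<kappa> * M r $$ (t, j) else 0)"
    unfolding sum_distrib_right by (subst sum.swap) (intro sum.cong refl, auto)
  also have "\<dots> = (\<Sum>\<kappa>\<in>{..<r} \<rightarrow>\<^sub>E {..<n}. W \<kappa> * M r $$ (start \<kappa> r, j))"
  proof (intro sum.cong refl)
    fix \<kappa> assume "\<kappa> \<in> {..<r} \<rightarrow>\<^sub>E {..<n}"
    hence "start \<kappa> r < n" using ij(1) by (auto simp: start_def PiE_iff)
    thus "(\<Sum>t<n. if t = start \<kappa> r then W \<kappa> * M r $$ (t, j) else 0) = W \<kappa> * M r $$ (start \<kappa> r, j)" by simp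
  qed
  also have "\<dots> = (\<Sum>t<n. if t = j then \<Sum>\<kappa>\<in>{..<r} \<rightarrow>\<^sub>E {..<n}. W \<kappa> * M r $$ (start \<kappa> r, t) else 0)"
    using Suc.prems(2) by simp
  also have "\<dots> = (\<Sum>t<n. \<Sum>\<kappa>\<in>{..<r} \<rightarrow>\<^sub>E {..<n}. of_bool (start (\<kappa>(r := t)) (Suc r) = j)
        * (\<Prod>l<Suc r. M l $$ (start (\<kappa>(r := t)) l, (\<kappa>(r := t)) l)))"
  proof (rule sum.cong[OF refl])
    fix t assume "t \<in> {..<n}"
    have st: "start (\<kappa>(r := t)) l = start \<kappa> l" if "l \<le> r" for l and \<kappa> :: "nat \<Rightarrow> nat"
      using that by (auto simp: start_def)
    have "(\<Prod>l<Suc r. M l $$ (start (\<kappa>(r := t)) l, (\<kappa>(r := t)) l)) = W \<kappa> * M r $$ (start \<kappa> r, t)" for \<kappa>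
      by (simp add: W_def st)
    moreover have "start (\<kappa>(r := t)) (Suc r) = t" for \<kappa> by (simp add: start_def)
    ultimately show "(if t = j then \<Sum>\<kappa>\<in>{..<r} \<rightarrow>\<^sub>E {..<n}. W \<kappa> * M r $$ (start \<kappa> r, t) else 0)
      = (\<Sum>\<kappa>\<in>{..<r} \<rightarrow>\<^sub>E {..<n}. of_bool (start (\<kappa>(r := t)) (Suc r) = j)
        * (\<Prod>l<Suc r. M l $$ (start (\<kappa>(r := t)) l, (\<kappa>(r := t)) l)))"
      by (simp only:) simp
  qed
  finally show ?case unfolding sum_PiE_lessThan_Suc .
qed

lemma mat_trace_foldr:
  fixes M :: "nat \<Rightarrow> 'a::comm_semiring_1 mat"
  assumes M: "\<And>l. l < r \<Longrightarrow> M l \<in> carrier_mat n n" and r: "r > 0"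
  shows "mat_trace (foldr (*) (map M [0..<r]) (1\<^sub>m n))
       = (\<Sum>\<kappa>\<in>{..<r} \<rightarrow>\<^sub>E {..<n}. \<Prod>l<r. M l $$ (\<kappa> (cyc_pred r l), \<kappa> l))"
proof -
  define W where "W i \<kappa> = (\<Prod>l<r. M l $$ (if l = 0 then i else \<kappa> (l - 1), \<kappa> l))" for i and \<kappa> :: "nat \<Rightarrow> nat"
  have "dim_row (foldr (*) (map M [0..<r]) (1\<^sub>m n)) = n"
    by (rule carrier_matD(1)[OF foldr_map_mat_carrier[OF M]])
  moreover have "foldr (*) (map M [0..<r]) (1\<^sub>m n) $$ (i, i)
      = (\<Sum>\<kappa>\<in>{..<r} \<rightarrow>\<^sub>E {..<n}. of_bool (\<kappa> (r - 1) = i) * W i \<kappa>)" if "i < n" for i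
    using foldr_mat_mult_entry[OF M that that] r by (simp add: W_def)
  ultimately have "mat_trace (foldr (*) (map M [0..<r]) (1\<^sub>m n))
      = (\<Sum>i<n. \<Sum>\<kappa>\<in>{..<r} \<rightarrow>\<^sub>E {..<n}. of_bool (\<kappa> (r - 1) = i) * W i \<kappa>)"
    by (simp add: mat_trace_def)
  also have "\<dots> = (\<Sum>\<kappa>\<in>{..<r} \<rightarrow>\<^sub>E {..<n}. \<Sum>i<n. if i = \<kappa> (r - 1) then W i \<kappa> else 0)"
    by (subst sum.swap) (intro sum.cong refl, auto)
  also have "\<dots> = (\<Sum>\<kappa>\<in>{..<r} \<rightarrow>\<^sub>E {..<n}. W (\<kappa> (r - 1)) \<kappa>)"
  proof (intro sum.cong refl)
    fix \<kappa> assume "\<kappa> \<in> {..<r} \<rightarrow>\<^sub>E {..<n}"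
    hence "\<kappa> (r - 1) \<in> {..<n}" using r by (intro PiE_mem[of \<kappa> "{..<r}" "\<lambda>_. {..<n}"]) auto
    thus "(\<Sum>i<n. if i = \<kappa> (r - 1) then W i \<kappa> else 0) = W (\<kappa> (r - 1)) \<kappa>" by simp
  qed
  also have "\<dots> = (\<Sum>\<kappa>\<in>{..<r} \<rightarrow>\<^sub>E {..<n}. \<Prod>l<r. M l $$ (\<kappa> (cyc_pred r l), \<kappa> l))"
  proof -
    have "(if l = 0 then \<kappa> (r - 1) else \<kappa> (l - 1)) = \<kappa> (cyc_pred r l)"
      if "l < r" for l and \<kappa> :: "nat \<Rightarrow> nat"
      using that cyc_pred_Suc[of "l - 1" r] by (cases l) (auto simp: cyc_pred_def)
    thus ?thesis unfolding W_def by (intro sum.cong prod.cong refl) simp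
  qed
  finally show ?thesis .
qed

lemma det_foldr:
  fixes M :: "nat \<Rightarrow> 'a::comm_ring_1 mat"
  assumes "\<And>l. l < r \<Longrightarrow> M l \<in> carrier_mat n n"
  shows "Determinant.det (foldr (*) (map M [0..<r]) (1\<^sub>m n)) = (\<Prod>l<r. Determinant.det (M l))"
  using assms
proof (induction r)
  case (Suc r)
  have "foldr (*) (map M [0..<Suc r]) (1\<^sub>m n) = foldr (*) (map M [0..<r]) (1\<^sub>m n) * M r"
    using Suc.prems by (rule foldr_map_mat_Suc)
  moreover have "foldr (*) (map M [0..<r]) (1\<^sub>m n) \<in> carrier_mat n n"
    using Suc.prems by (intro foldr_map_mat_carrier) simp
  ultimately show ?case using Suc by (simp add: det_mult[of _ n])
qed simp

section \<open>The matrix H\<close>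

definition fourier_entry :: "nat \<Rightarrow> complex \<Rightarrow> letter \<Rightarrow> int \<Rightarrow> int \<Rightarrow> complex" where
  "fourier_entry n q x i j = (case x of L \<Rightarrow> q powi (i * j) | R \<Rightarrow> q powi (inv2 n * (i - j)\<^sup>2))"

locale layered_bundle = nz_word w
  for w :: "letter list" +
  fixes n :: nat and a m :: int and z :: "nat \<Rightarrow> complex"
  assumes odd_n: "odd n" and coprime_a: "coprime a (int n)" and complete: "complete_structure w z"
begin

abbreviation q :: complex where "q \<equiv> root_exp n a"
abbreviation \<theta> :: "nat \<Rightarrow> complex" where "\<theta> \<equiv> shape_root n z"
abbreviation d :: "nat \<Rightarrow> complex" where "d \<equiv> diag_base n q w m z"

lemma n_pos: "n > 0" using odd_n by (rule odd_pos)

lemma coprime_minus_two_a: "coprime (- 2 * a) (int n)"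
  using coprime_a odd_n by simp

lemma q_nonzero: "q \<noteq> 0" by (simp add: root_exp_def)

lemma q_add: "q powi (k + l) = q powi k * q powi l"
  using q_nonzero by (simp add: power_int_add)

lemma q_period: "q powi (int n * k) = 1"
  using root_exp_power_n[OF n_pos, of a] by (simp add: power_int_mult)

lemma q_cong: "k mod int n = l mod int n \<Longrightarrow> q powi k = q powi l"
proof -
  assume eq: "k mod int n = l mod int n"
  have red: "q powi k = q powi (k mod int n)" for k
  proof -
    have "q powi k = q powi (int n * (k div int n) + k mod int n)" by simp
    thus ?thesis by (simp only: q_add q_period mult_1)
  qed
  show ?thesis unfolding red[of k] red[of l] eq ..
qed

lemma q_half: "q powi (2 * inv2 n * k) = q powi k"
proof -
  have "2 * inv2 n * k = k + int n * k"
    unfolding two_inv2[OF odd_n] by (simp add: algebra_simps)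
  thus ?thesis by (simp only: q_add q_period mult_1_right)
qed

lemma q_sum: "finite A \<Longrightarrow> q powi (\<Sum>x\<in>A. f x) = (\<Prod>x\<in>A. q powi f x)"
  by (induction A rule: finite_induct) (auto simp: q_add)

lemma q_minus_two: "q powi (- 2) = root_exp n (- 2 * a)"
  unfolding root_exp_powi by (simp add: root_exp_def mult_ac)

lemma z_nonreal: "i < N \<Longrightarrow> z i \<noteq> 0 \<and> z i \<noteq> 1"
  using complete by (auto simp: complete_structure_def)

lemma \<theta>_power: "i < N \<Longrightarrow> 1 - (1 / \<theta> i) ^ n = z i"
proof -
  assume "i < N"
  hence "shape' z i \<noteq> 0" using z_nonreal by (simp add: shape'_def)
  moreover have "\<theta> i ^ n = exp (of_nat n * (ln (shape' z i) / of_nat n))"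
    unfolding shape_root_def by (rule exp_of_nat_mult[symmetric])
  ultimately have "\<theta> i ^ n = shape' z i" using n_pos by simp
  thus ?thesis by (simp add: power_divide shape'_def)
qed

text \<open>The exponent \<open>(1 - n\<^sup>2) / 2\<close> of \<open>exp (\<pi>\<i> \<eta>\<^sub>i)\<close> is even for odd \<open>n\<close>.\<close>
lemma d_power: "i < N \<Longrightarrow> d i ^ n * z i = 1"
proof -
  assume i: "i < N"
  obtain h where h: "n = 2 * h + 1" using odd_n by (auto elim: oddE)
  define \<eta> where "\<eta> = nzeta w $ i"
  define e where "e = (1 - of_nat n ^ 2) / (2 * of_nat n) * pi * \<i> * of_int \<eta> - ln (z i) / of_nat n"
  have "of_nat n * e = (1 - of_nat n ^ 2) / 2 * pi * \<i> * of_int \<eta> - ln (z i)"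
    unfolding e_def using n_pos by (simp add: field_simps)
  also have "\<dots> = \<i> * pi * of_int (2 * (- (int h * (int h + 1) * \<eta>))) + - ln (z i)"
    by (simp add: h power2_eq_square field_simps)
  finally have "exp e ^ n = exp (\<i> * pi * of_int (2 * (- (int h * (int h + 1) * \<eta>)))) * exp (- ln (z i))"
    by (simp only: exp_of_nat_mult[symmetric] exp_add)
  also have "exp (\<i> * pi * of_int (2 * (- (int h * (int h + 1) * \<eta>)))) = 1"
    unfolding exp_minus_one_power minus_one_powi by simp
  finally have "exp e ^ n = 1 / z i" using z_nonreal[OF i] by (simp add: exp_minus divide_inverse)
  moreover have "(q powi k) ^ n = 1" for k
    using q_period[of k] by (simp only: mult.commute[of _ k] power_int_mult power_int_of_nat)
  moreover have "d i = q powi (m * beta w i - inv2 n * \<eta>) * exp e"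
    by (simp add: diag_base_def e_def \<eta>_def)
  ultimately show ?thesis using z_nonreal[OF i] by (simp add: power_mult_distrib)
qed

definition diag_entry :: "nat \<Rightarrow> int \<Rightarrow> complex" where
  "diag_entry i k = d i powi k * qpoch (1 / \<theta> i) (q powi (- 2)) k"

text \<open>Advancing \<open>k\<close> by \<open>n\<close> multiplies the entry by \<open>d\<^sup>n\<close> and by a product over all powers of \<open>\<xi>\<close>, that is
  by \<open>d\<^sup>n (1 - x\<^sup>n) = d\<^sup>n z = 1\<close>.\<close>
lemma diag_entry_mod:
  assumes i: "i < N"
  shows "diag_entry i (k mod int n) = diag_entry i k"
proof (rule periodic_mod)
  fix k
  define \<xi> where "\<xi> = root_exp n (- 2 * a)"
  define x where "x = 1 / \<theta> i"
  have \<xi>0: "\<xi> \<noteq> 0" by (simp add: \<xi>_def root_exp_def)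
  have \<xi>x: "(\<xi> powi j * x) ^ n = 1 - z i" for j
  proof -
    have "(\<xi> powi j) ^ n = (\<xi> ^ n) powi j"
      by (simp only: power_int_of_nat[symmetric] power_int_mult[symmetric] mult.commute)
    hence "(\<xi> powi j * x) ^ n = x ^ n"
      using root_exp_power_n[OF n_pos] by (simp add: \<xi>_def power_mult_distrib)
    thus ?thesis unfolding \<theta>_power[OF i, symmetric] by (simp add: x_def)
  qed
  have nz: "1 - \<xi> powi j * x \<noteq> 0" for j
  proof
    assume "1 - \<xi> powi j * x = 0"
    hence "\<xi> powi j * x = 1" by simp
    thus False using \<xi>x[of j] z_nonreal[OF i] by simp
  qed
  have "qpoch x \<xi> (k + int n) = qpoch x \<xi> k * z i"
    unfolding qpoch_add[OF \<xi>0 nz]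
      prod_one_minus_root_exp[OF n_pos coprime_minus_two_a, folded \<xi>_def] \<xi>x by simp
  moreover have "d i powi (k + int n) = d i powi k * d i ^ n"
    using d_power[OF i] n_pos by (subst power_int_add) (auto simp: power_0_left)
  ultimately show "diag_entry i (k + int n) = diag_entry i k"
    using d_power[OF i] unfolding diag_entry_def q_minus_two \<xi>_def[symmetric] x_def[symmetric]
    by (simp add: mult_ac)
qed

lemma fourier_entry_mod:
  "fourier_entry n q x (i mod int n) (j mod int n) = fourier_entry n q x i j"
proof -
  have ij: "[i mod int n = i] (mod int n)" "[j mod int n = j] (mod int n)"
    by (simp_all add: cong_def)
  have "q powi (i mod int n * (j mod int n)) = q powi (i * j)"
    by (rule q_cong[OF cong_mult[OF ij, unfolded cong_def]])
  moreover have "q powi (inv2 n * (i mod int n - j mod int n)\<^sup>2) = q powi (inv2 n * (i - j)\<^sup>2)"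
    by (rule q_cong[OF cong_scalar_left[OF cong_pow[OF cong_diff[OF ij]], unfolded cong_def]])
  ultimately show ?thesis by (simp add: fourier_entry_def split: letter.split)
qed

definition layer :: "nat \<Rightarrow> complex mat" where
  "layer i = fourier_factor n q (w ! i) * diag_factor n q w m z i"

lemma diag_factor_eq: "diag_factor n q w m z i = mat_diag n (\<lambda>k. diag_entry i (int k))"
  by (rule eq_matI) (auto simp: diag_factor_def mat_diag_def diag_entry_def)

lemma fourier_factor_carrier: "fourier_factor n q x \<in> carrier_mat n n"
  by (simp add: fourier_factor_def)

lemma layer_carrier: "layer i \<in> carrier_mat n n"
  unfolding layer_def diag_factor_eq using fourier_factor_carrier by (intro mult_carrier_mat[of _ n n]) auto

lemma layer_entry:
  assumes "k < n" "l < n"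
  shows "layer i $$ (k, l) = of_real (1 / sqrt (real n)) * fourier_entry n q (w ! i) (int k) (int l) * diag_entry i (int l)"
  unfolding layer_def diag_factor_eq mat_diag_mult_right[OF fourier_factor_carrier]
  using assms by (simp add: fourier_factor_def fourier_entry_def)

lemma Hmat_eq: "Hmat n q w m z = foldr (*) (map layer [0..<N]) (1\<^sub>m n)"
  unfolding Hmat_def layer_def[abs_def] ..

text \<open>The weight of a closed path of integers; by periodicity only the residues modulo \<open>n\<close> count.\<close>
definition cyclic_weight :: "(nat \<Rightarrow> int) \<Rightarrow> complex" where
  "cyclic_weight k = (\<Prod>i<N. of_real (1 / sqrt (real n))
     * fourier_entry n q (w ! i) (k (cyc_pred N i)) (k i) * diag_entry i (k i))"

lemma trace_Hmat:
  "mat_trace (Hmat n q w m z) = (\<Sum>\<kappa>\<in>{..<N} \<rightarrow>\<^sub>E {..<n}. cyclic_weight (\<lambda>i. int (\<kappa> i)))"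
proof -
  have "mat_trace (Hmat n q w m z) = (\<Sum>\<kappa>\<in>{..<N} \<rightarrow>\<^sub>E {..<n}. \<Prod>i<N. layer i $$ (\<kappa> (cyc_pred N i), \<kappa> i))"
    unfolding Hmat_eq by (rule mat_trace_foldr[OF layer_carrier N_pos])
  also have "\<dots> = (\<Sum>\<kappa>\<in>{..<N} \<rightarrow>\<^sub>E {..<n}. cyclic_weight (\<lambda>i. int (\<kappa> i)))"
    unfolding cyclic_weight_def
  proof (intro sum.cong prod.cong refl layer_entry)
    fix \<kappa> i assume "\<kappa> \<in> {..<N} \<rightarrow>\<^sub>E {..<n}" "i \<in> {..<N}"
    thus "\<kappa> (cyc_pred N i) < n" "\<kappa> i < n"
      using cyc_pred_less[OF N_pos, of i] by (auto simp: PiE_iff)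
  qed
  finally show ?thesis .
qed

lemma cyclic_weight_cong:
  assumes "\<And>i. i < N \<Longrightarrow> k i mod int n = l i mod int n"
  shows "cyclic_weight k = cyclic_weight l"
  unfolding cyclic_weight_def
proof (intro prod.cong refl arg_cong2[where f = "(*)"])
  fix i assume i: "i \<in> {..<N}"
  have eq: "k i mod int n = l i mod int n" "k (cyc_pred N i) mod int n = l (cyc_pred N i) mod int n"
    using assms[of i] assms[OF cyc_pred_less[OF N_pos, of i]] i by auto
  have "fourier_entry n q (w ! i) (k (cyc_pred N i) mod int n) (k i mod int n)
      = fourier_entry n q (w ! i) (l (cyc_pred N i) mod int n) (l i mod int n)"
    "diag_entry i (k i mod int n) = diag_entry i (l i mod int n)"
    by (simp_all only: eq)
  thus "fourier_entry n q (w ! i) (k (cyc_pred N i)) (k i) = fourier_entry n q (w ! i) (l (cyc_pred N i)) (l i)"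
    "diag_entry i (k i) = diag_entry i (l i)"
    using i by (simp_all only: fourier_entry_mod diag_entry_mod lessThan_iff)
qed

text \<open>Multiplication by \<open>-2\<close> is a permutation of the residues modulo the odd number \<open>n\<close>; its inverse is
  multiplication by \<open>- inv2 n\<close>.\<close>
lemma trace_Hmat_rescaled:
  "mat_trace (Hmat n q w m z) = (\<Sum>k\<in>{..<N} \<rightarrow>\<^sub>E {0..<int n}. cyclic_weight (\<lambda>i. - 2 * k i))"
proof -
  have inv: "(- inv2 n * (- 2 * k)) mod int n = k mod int n" "(- 2 * (- inv2 n * k)) mod int n = k mod int n" for k
  proof -
    have "2 * inv2 n * k = k + int n * k"
      unfolding two_inv2[OF odd_n] by (simp add: algebra_simps)
    moreover have "- inv2 n * (- 2 * k) = 2 * inv2 n * k" "- 2 * (- inv2 n * k) = 2 * inv2 n * k"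
      by simp_all
    ultimately show "(- inv2 n * (- 2 * k)) mod int n = k mod int n" "(- 2 * (- inv2 n * k)) mod int n = k mod int n"
      by (simp_all only: mod_mult_self2)
  qed
  define rescale where "rescale k = (\<lambda>i\<in>{..<N}. nat (- 2 * k i mod int n))" for k :: "nat \<Rightarrow> int"
  define unscale where "unscale \<kappa> = (\<lambda>i\<in>{..<N}. - inv2 n * int (\<kappa> i) mod int n)" for \<kappa> :: "nat \<Rightarrow> nat"
  have "(\<Sum>k\<in>{..<N} \<rightarrow>\<^sub>E {0..<int n}. cyclic_weight (\<lambda>i. - 2 * k i))
      = (\<Sum>\<kappa>\<in>{..<N} \<rightarrow>\<^sub>E {..<n}. cyclic_weight (\<lambda>i. int (\<kappa> i)))"
  proof (rule sum.reindex_bij_witness[of _ unscale rescale])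
    fix k assume k: "k \<in> {..<N} \<rightarrow>\<^sub>E {0..<int n}"
    show "rescale k \<in> {..<N} \<rightarrow>\<^sub>E {..<n}" using n_pos by (auto simp: rescale_def nat_less_iff)
    show "unscale (rescale k) = k"
    proof
      fix i
      show "unscale (rescale k) i = k i"
      proof (cases "i < N")
        case True
        have "int (rescale k i) = - 2 * k i mod int n"
          using True n_pos unfolding rescale_def by (simp only: restrict_apply' lessThan_iff nat_0_le pos_mod_sign of_nat_0_less_iff)
        hence "unscale (rescale k) i = - inv2 n * (- 2 * k i mod int n) mod int n"
          using True unfolding unscale_def by (simp only: restrict_apply' lessThan_iff)
        also have "\<dots> = - inv2 n * (- 2 * k i) mod int n" by (rule mod_mult_right_eq)
        also have "\<dots> = k i mod int n" by (rule inv)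
        also have "\<dots> = k i" using PiE_mem[OF k, of i] True by simp
        finally show ?thesis .
      qed (use PiE_arb[OF k] in \<open>simp add: unscale_def\<close>)
    qed
    show "cyclic_weight (\<lambda>i. int (rescale k i)) = cyclic_weight (\<lambda>i. - 2 * k i)"
      using n_pos by (intro cyclic_weight_cong) (simp add: rescale_def)
  next
    fix \<kappa> assume \<kappa>: "\<kappa> \<in> {..<N} \<rightarrow>\<^sub>E {..<n}"
    show "unscale \<kappa> \<in> {..<N} \<rightarrow>\<^sub>E {0..<int n}" using n_pos by (auto simp: unscale_def)
    show "rescale (unscale \<kappa>) = \<kappa>"
    proof
      fix i
      show "rescale (unscale \<kappa>) i = \<kappa> i"
      proof (cases "i < N")
        case True
        hence "rescale (unscale \<kappa>) i = nat (- 2 * (- inv2 n * int (\<kappa> i) mod int n) mod int n)"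
          unfolding rescale_def unscale_def by (simp only: restrict_apply' lessThan_iff)
        also have "- 2 * (- inv2 n * int (\<kappa> i) mod int n) mod int n = - 2 * (- inv2 n * int (\<kappa> i)) mod int n"
          by (rule mod_mult_right_eq)
        also have "\<dots> = int (\<kappa> i) mod int n" by (rule inv)
        also have "\<dots> = int (\<kappa> i)" using PiE_mem[OF \<kappa>, of i] True by simp
        finally show ?thesis by simp
      qed (use PiE_arb[OF \<kappa>] in \<open>simp add: rescale_def\<close>)
    qed
  qed
  thus ?thesis by (simp add: trace_Hmat)
qed

text \<open>By the symmetry of \<open>Q\<close> and the gluing equations, the left-hand side is
  \<open>exp (\<pi>\<i> k\<cdot>\<eta> - (\<pi>\<i> k\<cdot>\<eta> - 2 k\<cdot>log z) / n)\<close>. The right-hand side has \<open>n \<pi>\<i> k\<cdot>\<eta>\<close> in place of the first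
  term of the exponent, which makes no difference as \<open>n\<close> is odd.\<close>
lemma \<theta>_monomial:
  fixes k :: "nat \<Rightarrow> int"
  shows "(- 1) powi (\<Sum>i<N. k i * nzeta w $ i) * (\<Prod>i<N. \<theta> i powi (- layer_form w k i))
    = (\<Prod>i<N. exp ((1 - of_nat n ^ 2) / (2 * of_nat n) * pi * \<i> * of_int (nzeta w $ i)
            - ln (z i) / of_nat n) powi (- 2 * k i))"
proof -
  obtain h where h: "n = 2 * h + 1" using odd_n by (auto elim: oddE)
  define S where "S = (\<Sum>i<N. k i * nzeta w $ i)"
  define Z where "Z = (\<Sum>i<N. of_int (k i) * ln (z i))"
  define lz where "lz i = ln (shape' z i)" for i
  have of_int_form: "of_int (layer_form w k i) = (layer_form w (\<lambda>j. of_int (k j)) i :: complex)" for i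
    by (simp add: layer_form_def head_part_def tail_part_def Let_def split: letter.split)
  have "(\<Sum>i<N. of_int (layer_form w k i) * lz i) = (\<Sum>i<N. of_int (k i) * layer_form w lz i)"
    unfolding of_int_form by (subst sum_layer_form_symmetric[symmetric]) (simp add: mult.commute)
  also have "\<dots> = (\<Sum>i<N. of_int (k i) * (pi * \<i> * of_int (nzeta w $ i) - 2 * ln (z i)))"
  proof (intro sum.cong refl arg_cong2[where f = "(*)"])
    fix i assume "i \<in> {..<N}"
    hence "layer_form w lz i + 2 * ln (z i) = pi * \<i> * of_int (nzeta w $ i)"
      using layer_form_log_shapes[OF complete, of i] unfolding lz_def[abs_def] by simp
    thus "layer_form w lz i = pi * \<i> * of_int (nzeta w $ i) - 2 * ln (z i)"
      by (simp only: eq_diff_eq)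
  qed
  also have "\<dots> = pi * \<i> * of_int S - 2 * Z"
    by (simp add: S_def Z_def algebra_simps sum_subtractf sum_distrib_left)
  finally have sum_lz: "(\<Sum>i<N. of_int (layer_form w k i) * lz i) = pi * \<i> * of_int S - 2 * Z" .
  have "(\<Prod>i<N. \<theta> i powi (- layer_form w k i)) = (\<Prod>i<N. exp (of_int (- layer_form w k i) * (lz i / of_nat n)))"
    by (simp only: shape_root_def exp_power_int lz_def)
  also have "\<dots> = exp (\<Sum>i<N. of_int (- layer_form w k i) * (lz i / of_nat n))"
    by (simp only: exp_sum finite_lessThan)
  also have "(\<Sum>i<N. of_int (- layer_form w k i) * (lz i / of_nat n))
      = - (pi * \<i> * of_int S - 2 * Z) / of_nat n"
    unfolding sum_lz[symmetric] by (simp add: sum_negf sum_divide_distrib)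
  finally have lhs: "(- 1) powi S * (\<Prod>i<N. \<theta> i powi (- layer_form w k i))
     = exp (\<i> * pi * of_int S + - (pi * \<i> * of_int S - 2 * Z) / of_nat n)"
    unfolding exp_add exp_minus_one_power by simp
  have "(\<Prod>i<N. exp ((1 - of_nat n ^ 2) / (2 * of_nat n) * pi * \<i> * of_int (nzeta w $ i)
            - ln (z i) / of_nat n) powi (- 2 * k i))
     = exp (\<Sum>i<N. of_int (- 2 * k i) * ((1 - of_nat n ^ 2) / (2 * of_nat n) * pi * \<i> * of_int (nzeta w $ i)
            - ln (z i) / of_nat n))"
    by (simp only: exp_sum finite_lessThan exp_power_int)
  also have "(\<Sum>i<N. of_int (- 2 * k i) * ((1 - of_nat n ^ 2) / (2 * of_nat n) * pi * \<i> * of_int (nzeta w $ i)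
            - ln (z i) / of_nat n))
      = - (1 - of_nat n ^ 2) / of_nat n * pi * \<i> * of_int S + 2 / of_nat n * Z"
  proof -
    have "of_int (- 2 * k i) * ((1 - of_nat n ^ 2) / (2 * of_nat n) * pi * \<i> * of_int (nzeta w $ i)
            - ln (z i) / of_nat n)
        = - (1 - of_nat n ^ 2) / of_nat n * pi * \<i> * of_int (k i * nzeta w $ i)
          + 2 / of_nat n * (of_int (k i) * ln (z i))" for i
      using n_pos by (simp add: field_simps)
    thus ?thesis
      by (simp only: S_def Z_def of_int_sum sum.distrib sum_distrib_left[symmetric])
  qed
  also have "\<dots> = (\<i> * pi * of_int S + - (pi * \<i> * of_int S - 2 * Z) / of_nat n)
      + \<i> * pi * of_int (2 * (int h * S))"
  proof -
    have "of_int (2 * (int h * S)) = (of_nat n - 1) * complex_of_int S" by (simp add: h)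
    thus ?thesis
      using n_pos by (simp only:) (simp add: field_simps power2_eq_square)
  qed
  also have "exp \<dots> = exp (\<i> * pi * of_int S + - (pi * \<i> * of_int S - 2 * Z) / of_nat n)"
    unfolding exp_add[of _ "\<i> * pi * of_int (2 * (int h * S))"] exp_minus_one_power minus_one_powi by simp
  finally show ?thesis using lhs unfolding S_def by (simp only:)
qed

text \<open>The substitution \<open>\<kappa> = - 2 k\<close> cancels the factor one half in the exponents of \<open>q\<close>: the edge
  contributions become \<open>4 k\<^sub>i\<^sub>-\<^sub>1 k\<^sub>i\<close> for \<open>L\<close> and \<open>2 (k\<^sub>i - k\<^sub>i\<^sub>-\<^sub>1)\<^sup>2\<close> for \<open>R\<close>, and they add up to \<open>2 k\<^sup>t Q k\<close>. The
  identity holds for all integer vectors \<open>k\<close>.\<close>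
lemma summand_eq_cyclic_weight:
  "summand n (q\<^sup>2) w m \<theta> (vec N k) / of_real (real n powr (real N / 2)) = cyclic_weight (\<lambda>i. - 2 * k i)"
proof -
  define x y where "x i = k (cyc_pred N i)" and "y i = k i" for i
  define \<eta> where "\<eta> i = nzeta w $ i" for i
  have form: "vec N k \<bullet> (nzQ w *\<^sub>v vec N k) = (\<Sum>i<N. edge_pairing (w ! i) (x i) (y i) (x i) (y i))"
  proof -
    have "vec N k \<bullet> (nzQ w *\<^sub>v vec N k) = (\<Sum>i<N. k i * layer_form w k i)"
      using nzQ_mult_vec[of _ k] twoBinv(1)
      by (simp add: scalar_prod_def lessThan_atLeast0 nzQ_def del: index_mult_mat_vec)
    thus ?thesis unfolding sum_mult_layer_form x_def y_def .
  qed
  have lin: "vec N k \<bullet> (twoBinv w *\<^sub>v (nznu w - (2 * m) \<cdot>\<^sub>v unit_vec N (N - 1)))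
      = (\<Sum>i<N. y i * (\<eta> i - 2 * m * beta w i))"
    using twoBinv_nu_shift[of _ m] twoBinv(1)
    by (simp add: scalar_prod_def lessThan_atLeast0 y_def \<eta>_def del: index_mult_mat_vec)
  have eta: "vec N k \<bullet> nzeta w = (\<Sum>i<N. y i * \<eta> i)"
    using twoBinv(1) by (simp add: scalar_prod_def lessThan_atLeast0 y_def \<eta>_def nzeta_def del: index_mult_mat_vec)
  have "(q\<^sup>2) powi (inv2 n * l) = q powi l" for l
    using q_half[of l] by (metis mult.assoc of_nat_numeral power_int_mult power_int_of_nat)
  hence quad: "(q\<^sup>2) powi (inv2 n * (2 * (vec N k \<bullet> (nzQ w *\<^sub>v vec N k))
           + vec N k \<bullet> (twoBinv w *\<^sub>v (nznu w - (2 * m) \<cdot>\<^sub>v unit_vec N (N - 1)))))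
      = (\<Prod>i<N. q powi (2 * edge_pairing (w ! i) (x i) (y i) (x i) (y i)))
        * (\<Prod>i<N. q powi (y i * (\<eta> i - 2 * m * beta w i)))"
    unfolding form lin sum_distrib_left by (simp only: q_add q_sum[OF finite_lessThan])
  have fourier: "fourier_entry n q (w ! i) (- 2 * x i) (- 2 * y i)
      = q powi (2 * edge_pairing (w ! i) (x i) (y i) (x i) (y i))" for i
  proof (cases "w ! i")
    case R
    have expand: "inv2 n * (- 2 * x i - - 2 * y i)\<^sup>2 = 2 * inv2 n * (2 * ((y i - x i) * (y i - x i)))"
      by (simp add: power2_eq_square algebra_simps)
    show ?thesis
      by (simp only: R fourier_entry_def edge_pairing_def letter.case expand q_half)
  qed (simp add: fourier_entry_def edge_pairing_def mult_ac)
  have phase: "(q powi (m * beta w i - inv2 n * \<eta> i)) powi (- 2 * y i) = q powi (y i * (\<eta> i - 2 * m * beta w i))" for i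
  proof -
    have "(m * beta w i - inv2 n * \<eta> i) * (- 2 * y i) = - 2 * m * beta w i * y i + 2 * inv2 n * (\<eta> i * y i)"
      by (simp add: algebra_simps)
    hence "(q powi (m * beta w i - inv2 n * \<eta> i)) powi (- 2 * y i) = q powi (- 2 * m * beta w i * y i) * q powi (\<eta> i * y i)"
      by (simp only: power_int_mult[symmetric] q_add q_half)
    also have "\<dots> = q powi (y i * (\<eta> i - 2 * m * beta w i))"
      by (simp add: algebra_simps flip: q_add)
    finally show ?thesis .
  qed
  have poch: "qpoch (1 / \<theta> i) (q powi (- 2)) (- 2 * y i) = inverse (qpoch (q\<^sup>2 / \<theta> i) (q\<^sup>2) (2 * y i))" for i
    using qpoch_inverse_base[of "q\<^sup>2" "1 / \<theta> i" "- 2 * y i"] q_nonzero by (simp add: power_int_minus)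
  define E where "E i = exp ((1 - of_nat n ^ 2) / (2 * of_nat n) * pi * \<i> * of_int (\<eta> i)
            - ln (z i) / of_nat n)" for i
  have "cyclic_weight (\<lambda>i. - 2 * k i) = (\<Prod>i<N. of_real (1 / sqrt (real n))
      * q powi (2 * edge_pairing (w ! i) (x i) (y i) (x i) (y i))
      * (q powi (y i * (\<eta> i - 2 * m * beta w i)) * E i powi (- 2 * y i)
         * inverse (qpoch (q\<^sup>2 / \<theta> i) (q\<^sup>2) (2 * y i))))"
    unfolding cyclic_weight_def fourier[symmetric] phase[symmetric] poch[symmetric]
    by (intro prod.cong refl)
       (simp add: x_def y_def diag_entry_def diag_base_def E_def \<eta>_def power_int_mult_distrib)
  also have "\<dots> = of_real (1 / sqrt (real n)) ^ N
      * (\<Prod>i<N. q powi (2 * edge_pairing (w ! i) (x i) (y i) (x i) (y i)))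
      * (\<Prod>i<N. q powi (y i * (\<eta> i - 2 * m * beta w i))) * (\<Prod>i<N. E i powi (- 2 * y i))
      * (\<Prod>i<N. inverse (qpoch (q\<^sup>2 / \<theta> i) (q\<^sup>2) (2 * y i)))"
    by (simp only: prod.distrib prod_constant card_lessThan mult.assoc)
  also have "(\<Prod>i<N. E i powi (- 2 * y i)) = (- 1) powi (\<Sum>i<N. y i * \<eta> i) * (\<Prod>i<N. \<theta> i powi (- layer_form w k i))"
    unfolding E_def y_def \<eta>_def by (rule \<theta>_monomial[symmetric])
  also have "of_real (1 / sqrt (real n)) ^ N = 1 / complex_of_real (real n powr (real N / 2))"
  proof -
    have "sqrt (real n) ^ N = real n powr (real N / 2)"
      using n_pos by (simp add: powr_half_sqrt[symmetric] powr_powr powr_realpow[symmetric])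
    hence "(1 / sqrt (real n)) ^ N = 1 / real n powr (real N / 2)" by (simp add: power_divide)
    thus ?thesis by (metis of_real_1 of_real_divide of_real_power)
  qed
  finally have weight: "cyclic_weight (\<lambda>i. - 2 * k i) = 1 / complex_of_real (real n powr (real N / 2))
      * (\<Prod>i<N. q powi (2 * edge_pairing (w ! i) (x i) (y i) (x i) (y i)))
      * (\<Prod>i<N. q powi (y i * (\<eta> i - 2 * m * beta w i)))
      * ((- 1) powi (\<Sum>i<N. y i * \<eta> i) * (\<Prod>i<N. \<theta> i powi (- layer_form w k i)))
      * (\<Prod>i<N. inverse (qpoch (q\<^sup>2 / \<theta> i) (q\<^sup>2) (2 * y i)))" .
  have "(\<Prod>i<N. \<theta> i powi (- ((nzQ w *\<^sub>v vec N k) $ i)) / qpoch (q\<^sup>2 / \<theta> i) (q\<^sup>2) (2 * vec N k $ i))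
      = (\<Prod>i<N. \<theta> i powi (- layer_form w k i)) * (\<Prod>i<N. inverse (qpoch (q\<^sup>2 / \<theta> i) (q\<^sup>2) (2 * y i)))"
    unfolding prod.distrib[symmetric]
    by (intro prod.cong refl) (simp add: nzQ_mult_vec y_def divide_inverse del: index_mult_mat_vec)
  thus ?thesis
    unfolding summand_def Let_def quad eta weight by (simp add: mult_ac)
qed

lemma det_layer:
  assumes i: "i < N"
  shows "Determinant.det (layer i) = of_int (jacobi (- 2) n)
       * exp (- \<i> * pi * of_real (real n * dedekind_sum (- 2 * a) n)) ^ (fourier_weight (w ! i) + 1)
       * (z i ^ ((n - 1) div 2) * cyclic_dilog (- 2 * a) n (1 / \<theta> i) powi (- int n))"
proof -
  have "Determinant.det (diag_factor n q w m z i) = (\<Prod>k<n. d i ^ k * qpoch (1 / \<theta> i) (root_exp n (- 2 * a)) (int k))"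
    unfolding diag_factor_eq det_mat_diag q_minus_two[symmetric] by (simp add: diag_entry_def)
  also have "\<dots> = z i ^ ((n - 1) div 2) * (cyclic_dilog (- 2 * a) n (1 / \<theta> i) powi (- int n)
           * exp (- \<i> * pi * of_real (real n * dedekind_sum (- 2 * a) n)))"
    by (rule prod_cyclic_weights[OF odd_n coprime_minus_two_a d_power[OF i] \<theta>_power[OF i]])
  finally show ?thesis
    unfolding layer_def using fourier_factor_carrier
    by (subst det_mult[of _ n]) (simp_all add: diag_factor_eq det_fourier_factor[OF odd_n coprime_a] mult_ac)
qed

lemma sum_fourier_weight: "(\<Sum>i<length v. fourier_weight (v ! i) + 1) = 4 * count_list v L + 2 * count_list v R"
proof (induction v rule: rev_induct)
  case (snoc x v)
  have "(\<Sum>i<length v. fourier_weight ((v @ [x]) ! i) + 1) = (\<Sum>i<length v. fourier_weight (v ! i) + 1)"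
    by (intro sum.cong) (auto simp: nth_append)
  thus ?case using snoc by (cases x) (auto simp: fourier_weight_def)
qed simp

definition \<omega> :: complex where
  "\<omega> = of_int (jacobi (- 2) n) ^ N
     * exp (- 2 * pi * \<i> * of_nat (2 * count_list w L + count_list w R) * of_nat n * dedekind_sum (- 2 * a) n)"

lemma det_Hmat:
  "Determinant.det (Hmat n q w m z) = \<omega> * (\<Prod>i<N. z i ^ ((n - 1) div 2)
      * cyclic_dilog (- 2 * a) n (1 / \<theta> i) powi (- int n))"
proof -
  define E where "E = exp (- \<i> * pi * of_real (real n * dedekind_sum (- 2 * a) n))"
  have "Determinant.det (Hmat n q w m z) = (\<Prod>i<N. Determinant.det (layer i))"
    unfolding Hmat_eq by (rule det_foldr[OF layer_carrier])
  also have "\<dots> = (\<Prod>i<N. of_int (jacobi (- 2) n) * E ^ (fourier_weight (w ! i) + 1)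
       * (z i ^ ((n - 1) div 2) * cyclic_dilog (- 2 * a) n (1 / \<theta> i) powi (- int n)))"
    by (intro prod.cong refl) (simp add: det_layer E_def)
  also have "\<dots> = of_int (jacobi (- 2) n) ^ N * E ^ (4 * count_list w L + 2 * count_list w R)
       * (\<Prod>i<N. z i ^ ((n - 1) div 2) * cyclic_dilog (- 2 * a) n (1 / \<theta> i) powi (- int n))"
    by (simp only: prod.distrib prod_constant card_lessThan power_sum[symmetric] sum_fourier_weight)
  also have "E ^ (4 * count_list w L + 2 * count_list w R)
      = exp (- 2 * pi * \<i> * of_nat (2 * count_list w L + count_list w R) * of_nat n * dedekind_sum (- 2 * a) n)"
    unfolding E_def exp_of_nat_mult[symmetric] by (simp add: algebra_simps)
  finally show ?thesis by (simp add: \<omega>_def mult_ac)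
qed

text \<open>By the formula for Dedekind sums in terms of floor sums, \<open>24 n s(- 2 a, n)\<close> is an even integer.\<close>
lemma \<omega>_root_of_unity: "\<omega> ^ 12 = 1"
proof -
  define E where "E = exp (- \<i> * pi * of_real (real n * dedekind_sum (- 2 * a) n))"
  define c where "c = 2 * count_list w L + count_list w R"
  obtain h where h: "n = 2 * h + 1" using odd_n by (auto elim: oddE)
  have "\<omega> = of_int (jacobi (- 2) n) ^ N * E ^ (2 * c)"
    unfolding E_def exp_of_nat_mult[symmetric] \<omega>_def c_def by (simp add: algebra_simps)
  hence "\<omega> ^ 12 = of_int (jacobi (- 2) n) ^ (N * 12) * (E ^ 24) ^ c"
    by (simp add: power_mult_distrib flip: power_mult)
  moreover have "of_int (jacobi (- 2) n) ^ (N * 12) = (1 :: complex)"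
    unfolding jacobi_minus_two[OF odd_n] by (simp add: minus_one_power_iff flip: power_mult)
  moreover have "E ^ 24 = 1"
  proof -
    define F where "F = floor_sum n (- 2 * a)"
    have ds: "real n * dedekind_sum (- 2 * a) n = of_int (- 2 * a) * (real n - 1) * (2 * real n - 1) / 6
         - (of_int (- 2 * a) - 1) * real n * (real n - 1) / 2 - real n * (real n - 1) / 4 + of_int F"
      unfolding F_def by (rule dedekind_sum_eq_floor_sum[OF coprime_minus_two_a n_pos])
      \<comment> \<open>The factor 24 clears the denominators 6, 2 and 4 and leaves an even integer.\<close>
  define K where "K = - 4 * (- 2 * a) * (2 * int h) * (2 * int n - 1) + 12 * (- 2 * a - 1) * int n * (2 * int h)
            + 6 * int n * (2 * int h) - 24 * F"
    have "E ^ 24 = exp (of_nat 24 * (- \<i> * pi * of_real (real n * dedekind_sum (- 2 * a) n)))"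
      unfolding E_def by (rule exp_of_nat_mult[symmetric])
    also have "of_nat 24 * (- \<i> * pi * of_real (real n * dedekind_sum (- 2 * a) n)) = \<i> * pi * of_int K"
      unfolding ds K_def by (simp add: h field_simps)
    also have "exp \<dots> = 1" unfolding exp_minus_one_power minus_one_powi by (simp add: K_def)
    finally show ?thesis .
  qed
  ultimately show ?thesis by simp
qed

end

theorem proposition3p7:
  fixes w :: "letter list" and n :: nat and a m :: int
    and z \<theta> :: "nat \<Rightarrow> complex" and q \<zeta> \<omega> :: complex
  assumes "w \<noteq> []" and "hd w = L" and "last w = R"
    and "odd n" and "coprime a (int n)"
    and "q = exp (2 * pi * \<i> * of_int a / of_nat n)" and "\<zeta> = q\<^sup>2"
    and "complete_structure w z"
    and "\<theta> = shape_root n z"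
    and "\<omega> = of_int (jacobi (- 2) n) ^ length w
           * exp (- 2 * pi * \<i> * of_nat (2 * count_list w L + count_list w R) * of_nat n
                  * dedekind_sum (- 2 * a) n)"
  shows "mat_trace (Hmat n q w m z) =
           (\<Sum>k \<in> {..<length w} \<rightarrow>\<^sub>E {0..<int n}.
              summand n \<zeta> w m \<theta> (vec (length w) k) / of_real (real n powr (real (length w) / 2)))
       \<and> Determinant.det (Hmat n q w m z) =
           \<omega> * (\<Prod>i<length w. z i ^ ((n - 1) div 2)
                   * cyclic_dilog (- 2 * a) n (1 / \<theta> i) powi (- int n))
       \<and> (\<exists>r>0. \<omega> ^ r = 1)"
proof -
  interpret lb: layered_bundle w n a m z
    by unfold_locales (use assms in auto)
  have q: "q = root_exp n a" using assms(6) by (simp add: root_exp_def)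
  have \<omega>: "\<omega> = lb.\<omega>" using assms(10) by (simp add: lb.\<omega>_def)
  show ?thesis
    unfolding q \<open>\<zeta> = q\<^sup>2\<close> \<open>\<theta> = shape_root n z\<close> \<omega>
    using lb.trace_Hmat_rescaled lb.det_Hmat lb.\<omega>_root_of_unity
    by (auto simp: lb.summand_eq_cyclic_weight intro!: exI[of _ 12])
qed

end
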